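(* For every integer $n\ge1$ there exist $\alpha>1$ and $0<\beta<1$ such that the following holds. For every $\mu>0$ there exists an integer $k\ge1$ such that if $0\le h<\alpha^{-k-1}$, $\Gamma$ is an $(n,h)$ subset of the open cylinder $\mathcal{C}_1(0)=\{z\in\mathbf{R}^{n+1}:|z'|<1\}$ with $\mathscr{H}^n(\Gamma)<\infty$, $$\Gamma\subseteq\{x: x_{n+1}\le0\}\quad\text{and}\quad \Gamma\cap\{x: |x'|\le1/4,\ -\alpha^{-k-1}/48\le x_{n+1}\le0\}\ne\varnothing,$$ then $$\mathscr{L}^n\big(\mathbf{B}^n(0,1/3)\setminus A'_{\alpha^{-1}}(\Gamma)\big)\le\mu\,\mathscr{L}^n(\mathbf{B}^n(0,1/3)).$$
   Context: Notation: points of $\mathbf{R}^{n+1}\cong\mathbf{R}^n\times\mathbf{R}$ are written $z=(z',z_{n+1})$; $\mathbf{B}^n(x,\rho)$ is the closed ball of $\mathbf{R}^n$; $\mathscr{H}^n$ is the $n$-dimensional Hausdorff measure and $\mathscr{L}^n$ is Lebesgue measure on $\mathbf{R}^n$; $\overline{\Gamma}$ is the closure of $\Gamma$ in $\mathbf{R}^{n+1}$. $(n,h)$ subsets: let $\Omega\subseteq\mathbf{R}^{n+1}$ be open, $\Gamma$ relatively closed in $\Omega$ and $h\ge0$. $\Gamma$ is an $(n,h)$ subset of $\Omega$ if: whenever $x\in\Gamma$ and $f$ is a real-valued $\mathscr{C}^2$ function on a neighbourhood of $x$ such that $f|\Gamma$ has a local maximum at $x$ and $\nabla f(x)\ne0$,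 then $\operatorname{trace}_n D^2f(x)\le h|\nabla f(x)|$, where $\operatorname{trace}_n D^2f(x)$ is the sum of the lowest $n$ (of the $n+1$) eigenvalues, with multiplicity, of the Hessian $D^2f(x)$. Touching paraboloids: for $a>0$ and $x\in\mathbf{R}^n$, a paraboloid of center $x$ and opening $a$ is a function $P:\mathbf{R}^n\to\mathbf{R}$ of the form $P(y)=(a/2)|y-x|^2+t$ with $t\in\mathbf{R}$. For $f:\mathbf{R}^n\to\mathbf{R}$ put $\Sigma(f)=\{(x,f(x)):x\in\mathbf{R}^n\}$ and $\Sigma^+(f)=\{(x,y):y>f(x)\}$. A continuous $f$ touches a closed set $K\subseteq\mathbf{R}^{n+1}$ from above if $\Sigma(f)\cap K\ne\varnothing$ and $\Sigma^+(f)\cap K=\varnothing$. For $\Gamma$ relatively closed in $\mathcal{C}_1(0)$, let $P_{a,x}$ be the (unique, when it exists) paraboloid of opening $a$ and center $x$ touching $\overline{\Gamma}$ from above. Touching set: $A'_a(\Gamma)$ is the set of $z'\in\mathbf{R}^n$ such that $z=(z',z_{n+1})\in\Sigma(P_{a,x})\cap\overline{\Gamma}$ for some $z_{n+1}\in\mathbf{R}$ and some $x\in\mathbf{B}^n(0,1)$. *)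

theory Defs
  imports "HOL-Analysis.Analysis"
begin

text \<open>
  Points of \<open>R\<^sup>n \<times> R\<close> are pairs \<open>(z', z\<^sub>n\<^sub>+\<^sub>1)\<close> of type \<open>(real ^ 'n) \<times> real\<close>, with
  \<open>n = CARD('n)\<close>; the norm on the product type is the Euclidean one.
\<close>

subsection \<open>Hausdorff measure\<close>

text \<open>
  Normalised so that it agrees with Lebesgue measure in dimension \<open>n\<close>.  Covering sets have to
  be bounded because \<^const>\<open>diameter\<close> is meaningless on unbounded sets; the empty set counts
  zero also for \<open>n = 0\<close>.
\<close>

definition hausdorff_weight :: "nat \<Rightarrow> 'a::metric_space set \<Rightarrow> ennreal" where
  "hausdorff_weight n C =
     (if C = {} then 0 else ennreal (unit_ball_vol (real n) * (diameter C / 2) ^ n))"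

definition hausdorff_pre :: "nat \<Rightarrow> real \<Rightarrow> 'a::metric_space set \<Rightarrow> ennreal" where
  "hausdorff_pre n \<delta> A =
     Inf {(\<Sum>i. hausdorff_weight n (C i)) | C :: nat \<Rightarrow> 'a set.
            A \<subseteq> (\<Union>i. C i) \<and> (\<forall>i. bounded (C i) \<and> diameter (C i) \<le> \<delta>)}"

definition hausdorff :: "nat \<Rightarrow> 'a::metric_space set \<Rightarrow> ennreal" where
  "hausdorff n A = (SUP \<delta>\<in>{0<..}. hausdorff_pre n \<delta> A)"

subsection \<open>Gradient, Hessian and sums of eigenvalues\<close>

definition grad :: "('a::euclidean_space \<Rightarrow> real) \<Rightarrow> 'a \<Rightarrow> 'a" where
  "grad f x = (THE D. GDERIV f x :> D)"

definition hess :: "('a::euclidean_space \<Rightarrow> real) \<Rightarrow> 'a \<Rightarrow> 'a \<Rightarrow> 'a" where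
  "hess f x = frechet_derivative (grad f) (at x)"

definition C2_on :: "('a::euclidean_space \<Rightarrow> real) \<Rightarrow> 'a set \<Rightarrow> bool" where
  "C2_on f U \<longleftrightarrow> open U
     \<and> (\<forall>y\<in>U. f differentiable (at y))
     \<and> (\<forall>y\<in>U. grad f differentiable (at y))
     \<and> (\<forall>v. continuous_on U (\<lambda>y. hess f y v))"

definition eigenspace :: "('a::euclidean_space \<Rightarrow> 'a) \<Rightarrow> real \<Rightarrow> 'a set" where
  "eigenspace A l = {v. A v = l *\<^sub>R v}"

text \<open>
  The increasing list of the real eigenvalues, each repeated according to its geometric
  multiplicity.  For a self-adjoint \<open>A\<close>, such as the Hessian of a \<open>C\<^sup>2\<close> function, this is the
  usual multiplicity and the list has length \<open>DIM('a)\<close>.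
\<close>

definition eigenvalue_list :: "('a::euclidean_space \<Rightarrow> 'a) \<Rightarrow> real list" where
  "eigenvalue_list A =
     concat (map (\<lambda>l. replicate (dim (eigenspace A l)) l)
       (sorted_list_of_set {l. \<exists>v. v \<noteq> 0 \<and> A v = l *\<^sub>R v}))"

definition trace_low :: "nat \<Rightarrow> ('a::euclidean_space \<Rightarrow> 'a) \<Rightarrow> real" where
  "trace_low n A = sum_list (take n (eigenvalue_list A))"

subsection \<open>\<open>(n,h)\<close> subsets\<close>

definition nh_subset :: "real \<Rightarrow> ((real ^ 'n) \<times> real) set \<Rightarrow> ((real ^ 'n) \<times> real) set \<Rightarrow> bool" where
  "nh_subset h \<Omega> \<Gamma> \<longleftrightarrow> open \<Omega> \<and> closedin (top_of_set \<Omega>) \<Gamma> \<and> 0 \<le> h \<and>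
     (\<forall>x\<in>\<Gamma>. \<forall>U f. x \<in> U \<and> C2_on f U \<and> (\<forall>\<^sub>F y in at x within \<Gamma>. f y \<le> f x) \<and> grad f x \<noteq> 0
        \<longrightarrow> trace_low CARD('n) (hess f x) \<le> h * norm (grad f x))"

definition cylinder :: "real \<Rightarrow> ((real ^ 'n) \<times> real) set" where
  "cylinder r = {z. norm (fst z) < r}"

subsection \<open>Touching paraboloids\<close>

definition is_paraboloid :: "real \<Rightarrow> real ^ 'n \<Rightarrow> (real ^ 'n \<Rightarrow> real) \<Rightarrow> bool" where
  "is_paraboloid a x P \<longleftrightarrow> (\<exists>t. \<forall>y. P y = (a / 2) * (norm (y - x))\<^sup>2 + t)"

definition graph :: "(real ^ 'n \<Rightarrow> real) \<Rightarrow> ((real ^ 'n) \<times> real) set" where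
  "graph f = {(x, f x) | x. True}"

definition above_graph :: "(real ^ 'n \<Rightarrow> real) \<Rightarrow> ((real ^ 'n) \<times> real) set" where
  "above_graph f = {(x, y). y > f x}"

definition touches_from_above :: "(real ^ 'n \<Rightarrow> real) \<Rightarrow> ((real ^ 'n) \<times> real) set \<Rightarrow> bool" where
  "touches_from_above f K \<longleftrightarrow> continuous_on UNIV f \<and> closed K \<and>
     graph f \<inter> K \<noteq> {} \<and> above_graph f \<inter> K = {}"

text \<open>
  A touching paraboloid of given opening and center is unique when it exists, so the set below
  may quantify over \<open>P\<close>; centers without a touching paraboloid contribute nothing.
\<close>

definition touching_set :: "real \<Rightarrow> ((real ^ 'n) \<times> real) set \<Rightarrow> (real ^ 'n) set" where
  "touching_set a \<Gamma> =
     {z'. \<exists>s. \<exists>x\<in>cball 0 1. \<exists>P. is_paraboloid a x P \<and> touches_from_above P (closure \<Gamma>)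
            \<and> (z', s) \<in> graph P \<inter> closure \<Gamma>}"

end

theory Submission
  imports Defs
begin

text \<open>
The set \<open>\<Gamma>\<close> is a subsolution of an equation close to Laplace's equation, with a height function
that is not single-valued and possibly not defined everywhere.  The proof follows Savin's measure
estimate: the set of points of the ball of radius \<open>1/3\<close> that are touched from above by paraboloids
of opening \<open>a\<close> and center in the unit ball gains a fixed fraction of its complement when the opening
is multiplied by \<open>\<alpha>\<close>.  The hypothesis on the height provides a first contact with opening
\<open>\<alpha>\<^sup>-\<^sup>k\<^sup>-\<^sup>1\<close> (\<open>touching_set_meets_third_ball\<close>), and \<open>k\<close> multiplications lead to the opening
\<open>\<alpha>\<^sup>-\<^sup>1\<close>, so the untouched part shrinks geometrically in \<open>k\<close>.  Since \<open>h\<close> is below all the openings that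
occur, and slopes are of the order of the openings, the Laplacians of the barriers used below always
dominate the error terms.

The gain (\<open>measure_untouched_decay\<close>) rests on two barrier arguments, both of them applications of the
comparison principle \<open>nh_comparison\<close>.  A radial barrier shows that a paraboloid of opening \<open>a\<close>
touching at one point is almost attained, up to an error of order \<open>a r\<^sup>2\<close>, in each ball of
comparable radius \<open>r\<close> in the vicinity (\<open>nearby_point_of_contact\<close>).  Hence steeper paraboloids, with
centers filling a smaller ball, must touch in that ball.

To see that they touch in a set of proportional measure, one usually bounds the Jacobian of the map
from contact points to centers, by the area formula and second-order differentiability almost
everywhere.  Here a quadratic barrier shows directly that this map is Lipschitz
(\<open>contact_centers_Lipschitz\<close>), with a constant that depends on the dimension only.  Lipschitz maps
expand measure by a bounded factor, which is all that is needed, because the number of iterations makes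
up for the lack of a sharp constant.
\<close>

section \<open>Sums of the lowest eigenvalues of self-adjoint maps\<close>

lemma nonneg_quadratic_imp_zero:
  fixes c d :: real
  assumes "\<And>t. 0 \<le> t\<^sup>2 * d - 2 * t * c" "0 \<le> d"
  shows "c = 0"
proof -
  have "0 \<le> (c / (1 + d))\<^sup>2 * d - 2 * (c / (1 + d)) * c"
    by (rule assms)
  also have "\<dots> = - (c\<^sup>2 * (2 + d)) / (1 + d)\<^sup>2"
  proof -
    have "1 + d \<noteq> 0"
      using assms(2) by linarith
    then show ?thesis
      by (simp add: divide_simps) (simp add: algebra_simps power2_eq_square)
  qed
  finally have "c\<^sup>2 * (2 + d) \<le> 0"
    using assms(2) by (auto simp: divide_le_0_iff)
  then show ?thesis
    using assms(2) by (simp add: mult_le_0_iff)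
qed

text \<open>
A maximiser of the Rayleigh quotient on the unit sphere of an invariant subspace is an
eigenvector: with \<open>l\<close> the maximum, \<open>l |y|\<^sup>2 - A y \<bullet> y\<close> is a nonnegative quadratic form on the
subspace that vanishes at the maximiser \<open>x\<close>, so its derivative at \<open>x\<close> in the direction
\<open>l x - A x\<close> vanishes too.
\<close>

lemma self_adjoint_eigenvector_in_subspace:
  fixes A :: "'a::euclidean_space \<Rightarrow> 'a"
  assumes lin: "linear A" and sa: "\<And>x y. A x \<bullet> y = x \<bullet> A y"
    and V: "subspace V" "\<And>x. x \<in> V \<Longrightarrow> A x \<in> V" and ne: "y \<in> V" "y \<noteq> 0"
  obtains x l where "x \<in> V" "norm x = 1" "A x = l *\<^sub>R x"
proof -
  let ?S = "V \<inter> sphere 0 1"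
  have "compact ?S"
    using closed_subspace[OF V(1)] by (simp add: closed_Int_compact)
  moreover have "(1 / norm y) *\<^sub>R y \<in> ?S"
    using ne V(1) by (simp add: subspace_scale)
  moreover have "continuous_on ?S (\<lambda>x. A x \<bullet> x)"
    using lin by (intro continuous_intros linear_continuous_on) (simp add: linear_conv_bounded_linear)
  ultimately obtain x where x: "x \<in> ?S" and max: "\<And>y. y \<in> ?S \<Longrightarrow> A y \<bullet> y \<le> A x \<bullet> x"
    using continuous_attains_sup[of ?S "\<lambda>x. A x \<bullet> x"] by blast
  define l where "l = A x \<bullet> x"
  have x': "x \<in> V" "x \<bullet> x = 1"
    using x by (auto simp: norm_eq_1)
  define q where "q y = l * (y \<bullet> y) - A y \<bullet> y" for y
  have q: "0 \<le> q y" if "y \<in> V" for y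
  proof (cases "y = 0")
    case False
    let ?u = "(1 / norm y) *\<^sub>R y"
    have "A ?u \<bullet> ?u \<le> l"
      unfolding l_def using that False V(1) by (intro max) (simp add: subspace_scale)
    moreover have "A ?u \<bullet> ?u = (A y \<bullet> y) / (y \<bullet> y)"
      by (simp add: linear_scale[OF lin] dot_square_norm power2_eq_square)
    ultimately have "(A y \<bullet> y) / (y \<bullet> y) \<le> l"
      by metis
    then show ?thesis
      using False by (simp add: q_def divide_le_eq)
  qed (use linear_0[OF lin] in \<open>simp add: q_def\<close>)
  define w where "w = l *\<^sub>R x - A x"
  have wV: "w \<in> V"
    using V x'(1) by (simp add: w_def subspace_diff subspace_scale)
  have "q (x - t *\<^sub>R w) = t\<^sup>2 * q w - 2 * t * (w \<bullet> w)" for t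
  proof -
    have "w \<bullet> w = w \<bullet> (l *\<^sub>R x - A x)"
      by (simp add: w_def)
    then have "w \<bullet> A x = l * (w \<bullet> x) - w \<bullet> w"
      by (simp add: inner_diff_right)
    then have 1: "A x \<bullet> w = l * (w \<bullet> x) - w \<bullet> w" and 2: "A w \<bullet> x = l * (w \<bullet> x) - w \<bullet> w"
      by (simp_all add: sa[of w x] inner_commute[of "A x" w])
    have 3: "q x = 0"
      using x'(2) by (simp add: q_def l_def)
    have "q (x - t *\<^sub>R w) = q x - t * (l * (w \<bullet> x) * 2 - A w \<bullet> x - A x \<bullet> w) + t\<^sup>2 * q w"
      unfolding q_def linear_diff[OF lin] linear_scale[OF lin]
      by (simp add: inner_diff_left inner_diff_right inner_commute[of x w] algebra_simps power2_eq_square)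
    then show ?thesis
      unfolding 1 2 3 by (simp add: algebra_simps)
  qed
  moreover have "0 \<le> q (x - t *\<^sub>R w)" for t
    using V(1) x'(1) wV by (intro q) (simp add: subspace_diff subspace_scale)
  ultimately have "w \<bullet> w = 0"
    using nonneg_quadratic_imp_zero[of "q w" "w \<bullet> w"] q[OF wV] by metis
  then have "A x = l *\<^sub>R x"
    by (simp add: w_def)
  then show ?thesis
    using that x by auto
qed

text \<open>
The spectral theorem.  An orthonormal set of eigenvectors of the greatest possible size spans the
space, because its orthogonal complement is invariant and would otherwise contain another
eigenvector.
\<close>

lemma self_adjoint_orthonormal_eigenbasis:
  fixes A :: "'a::euclidean_space \<Rightarrow> 'a"
  assumes lin: "linear A" and sa: "\<And>x y. A x \<bullet> y = x \<bullet> A y"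
  obtains B l where "pairwise orthogonal B" "\<And>b. b \<in> B \<Longrightarrow> norm b = 1" "independent B"
    "finite B" "card B = DIM('a)" "span B = UNIV" "\<And>b. b \<in> B \<Longrightarrow> A b = l b *\<^sub>R b"
proof -
  define good where "good B \<longleftrightarrow> pairwise orthogonal B \<and> (\<forall>b\<in>B. norm b = 1) \<and> (\<forall>b\<in>B. \<exists>l. A b = l *\<^sub>R b)"
    for B
  have ind: "independent B" "finite B" "card B \<le> DIM('a)" if "good B" for B
  proof -
    show ind: "independent B"
      using that by (intro pairwise_orthogonal_independent) (auto simp: good_def)
    show "finite B" "card B \<le> DIM('a)"
      using independent_bound[OF ind] by auto
  qed
  have "good {}"
    by (auto simp: good_def)
  then obtain B where B: "good B" and max: "\<And>C. good C \<Longrightarrow> card C \<le> card B"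
    using ex_has_greatest_nat[of good "{}" card "DIM('a) + 1"] ind(3) by (metis less_Suc_eq_le Suc_eq_plus1)
  have "span B = UNIV"
  proof (rule ccontr)
    assume "span B \<noteq> UNIV"
    then have "span B \<subset> span UNIV"
      by auto
    then obtain y where y: "y \<noteq> 0" "\<And>x. x \<in> span B \<Longrightarrow> orthogonal y x"
      using orthogonal_to_subspace_exists_gen[of B UNIV] by metis
    define V where "V = {x. \<forall>b\<in>B. x \<bullet> b = 0}"
    have "subspace V"
      by (auto simp: V_def subspace_def inner_add_left)
    moreover have "A x \<in> V" if "x \<in> V" for x
    proof -
      have "A x \<bullet> b = 0" if "b \<in> B" for b
      proof -
        obtain m where "A b = m *\<^sub>R b"
          using B \<open>b \<in> B\<close> by (auto simp: good_def)
        then show ?thesis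
          using \<open>x \<in> V\<close> \<open>b \<in> B\<close> sa[of x b] by (simp add: V_def)
      qed
      then show ?thesis
        by (simp add: V_def)
    qed
    moreover have "y \<in> V"
      using y span_base by (auto simp: V_def orthogonal_def)
    ultimately obtain x l where x: "x \<in> V" "norm x = 1" "A x = l *\<^sub>R x"
      using self_adjoint_eigenvector_in_subspace[OF lin sa] y(1) by metis
    have "x \<notin> B"
      using x(1,2) unfolding V_def norm_eq_1 by auto
    moreover have "good (insert x B)"
      using B x unfolding good_def V_def pairwise_insert orthogonal_def by (auto simp: inner_commute)
    ultimately show False
      using max[of "insert x B"] ind(2)[OF B] by simp
  qed
  moreover from this have "card B = DIM('a)"
    using dim_span_eq_card_independent[OF ind(1)[OF B]] by simp
  moreover obtain l where "\<And>b. b \<in> B \<Longrightarrow> A b = l b *\<^sub>R b"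
    using B unfolding good_def by metis
  ultimately show ?thesis
    using that[of B l] B ind[OF B] unfolding good_def by auto
qed

lemma sum_inner_orthonormal_basis:
  fixes A :: "'a::euclidean_space \<Rightarrow> 'a"
  assumes lin: "linear A" and sa: "\<And>x y. A x \<bullet> y = x \<bullet> A y"
    and B: "pairwise orthogonal B" "\<And>b. b \<in> B \<Longrightarrow> norm b = 1" "finite B" "span B = UNIV"
  shows "(\<Sum>b\<in>B. A b \<bullet> b) = (\<Sum>e\<in>Basis. A e \<bullet> e)"
proof -
  have exp: "(\<Sum>b\<in>B. (x \<bullet> b) * (b \<bullet> y)) = x \<bullet> y" for x y
  proof -
    have "(\<Sum>b\<in>B. (x \<bullet> b) *\<^sub>R b) = x"
      using B by (intro orthonormal_basis_expand) auto
    then have "x \<bullet> y = (\<Sum>b\<in>B. (x \<bullet> b) *\<^sub>R b) \<bullet> y"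
      by simp
    then show ?thesis
      by (simp add: inner_sum_left)
  qed
  have "(\<Sum>b\<in>B. A b \<bullet> b) = (\<Sum>b\<in>B. \<Sum>e\<in>Basis. (A b \<bullet> e) * (b \<bullet> e))"
    by (simp add: euclidean_inner[symmetric])
  also have "\<dots> = (\<Sum>e\<in>Basis. \<Sum>b\<in>B. (A e \<bullet> b) * (b \<bullet> e))"
  proof -
    have "A b \<bullet> e = A e \<bullet> b" for b e
      by (metis sa inner_commute)
    then show ?thesis
      by (subst sum.swap) simp
  qed
  finally show ?thesis
    by (simp add: exp)
qed

text \<open>
Of the sorted eigenvalues only the largest is left out of \<^const>\<open>trace_low\<close>, so that no eigenvalue
has to be known in order to bound it below: a bound for the trace and one for the quadratic form on
unit vectors are enough.  The vector \<open>v\<close> is a unit eigenvector of the largest eigenvalue.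
\<close>

lemma trace_low_eq_trace_minus_largest:
  fixes A :: "'a::euclidean_space \<Rightarrow> 'a"
  assumes lin: "linear A" and sa: "\<And>x y. A x \<bullet> y = x \<bullet> A y" and N: "DIM('a) = Suc N"
  obtains v where "norm v = 1" "trace_low N A = (\<Sum>e\<in>Basis. A e \<bullet> e) - A v \<bullet> v"
proof -
  obtain B l where B: "pairwise orthogonal B" "\<And>b. b \<in> B \<Longrightarrow> norm b = 1" "independent B"
    "finite B" "card B = DIM('a)" "span B = UNIV" and l: "\<And>b. b \<in> B \<Longrightarrow> A b = l b *\<^sub>R b"
    using self_adjoint_orthonormal_eigenbasis[OF lin sa] by metis
  define Bl where "Bl m = {b \<in> B. l b = m}" for m
  \<comment> \<open>The multiplicity of an eigenvalue is the number of basis vectors that belong to it.\<close>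
  have eig: "eigenspace A m = span (Bl m)" for m
  proof (intro equalityI subsetI)
    fix x assume "x \<in> eigenspace A m"
    then have x: "A x = m *\<^sub>R x"
      by (simp add: eigenspace_def)
    have "(x \<bullet> b) *\<^sub>R b \<in> span (Bl m)" if "b \<in> B" for b
    proof (cases "l b = m")
      case True
      then show ?thesis
        using that by (intro span_scale span_base) (simp add: Bl_def)
    next
      case False
      have "m * (x \<bullet> b) = l b * (x \<bullet> b)"
        using sa[of x b] x l[OF that] by simp
      then show ?thesis
        using False by (simp add: span_zero)
    qed
    then have "(\<Sum>b\<in>B. (x \<bullet> b) *\<^sub>R b) \<in> span (Bl m)"
      by (rule span_sum)
    moreover have "(\<Sum>b\<in>B. (x \<bullet> b) *\<^sub>R b) = x"
      using B by (intro orthonormal_basis_expand) auto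
    ultimately show "x \<in> span (Bl m)"
      by simp
  next
    fix x assume "x \<in> span (Bl m)"
    moreover have "subspace (eigenspace A m)"
      using lin by (auto simp: eigenspace_def subspace_def linear_0 linear_add linear_scale algebra_simps)
    moreover have "Bl m \<subseteq> eigenspace A m"
      using l by (auto simp: Bl_def eigenspace_def)
    ultimately show "x \<in> eigenspace A m"
      using span_minimal by blast
  qed
  have indBl: "independent (Bl m)" for m
    using B(3) by (rule independent_mono) (auto simp: Bl_def)
  have dimE: "dim (eigenspace A m) = card (Bl m)" for m
    unfolding eig using indBl by (rule dim_span_eq_card_independent)
  have E: "{m. \<exists>v. v \<noteq> 0 \<and> A v = m *\<^sub>R v} = l ` B"
  proof (intro equalityI subsetI)
    fix m assume "m \<in> {m. \<exists>v. v \<noteq> 0 \<and> A v = m *\<^sub>R v}"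
    then obtain v where "v \<noteq> 0" "v \<in> span (Bl m)"
      using eig by (auto simp: eigenspace_def)
    then have "Bl m \<noteq> {}"
      by auto
    then show "m \<in> l ` B"
      by (auto simp: Bl_def)
  next
    fix m assume "m \<in> l ` B"
    then obtain b where "b \<in> B" "m = l b"
      by auto
    then show "m \<in> {m. \<exists>v. v \<noteq> 0 \<and> A v = m *\<^sub>R v}"
      using l[of b] B(2)[of b] by (intro CollectI exI[of _ b]) auto
  qed
  define L where "L = eigenvalue_list A"
  have Ldef: "L = concat (map (\<lambda>m. replicate (card (Bl m)) m) (sorted_list_of_set (l ` B)))"
    unfolding L_def eigenvalue_list_def E dimE ..
  have "length L = (\<Sum>m\<in>l ` B. card (Bl m))"
    using B(4) by (simp add: Ldef length_concat comp_def sum_list_distinct_conv_sum_set)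
  also have "\<dots> = card B"
    using sum.image_gen[OF B(4), of "\<lambda>_. 1 :: nat" l] by (simp add: Bl_def)
  finally have len: "length L = Suc N"
    using B(5) N by simp
  have sum_concat: "sum_list (concat (map (\<lambda>m. replicate (card (Bl m)) m) xs))
      = sum_list (map (\<lambda>m. of_nat (card (Bl m)) * m) xs)" for xs
    by (induction xs) (simp_all add: sum_list_replicate)
  have "sum_list L = (\<Sum>m\<in>l ` B. of_nat (card (Bl m)) * m)"
    using B(4) unfolding Ldef sum_concat by (simp add: sum_list_distinct_conv_sum_set)
  also have "\<dots> = (\<Sum>m\<in>l ` B. \<Sum>b\<in>{b \<in> B. l b = m}. l b)"
    by (intro sum.cong refl) (simp add: Bl_def)
  also have "\<dots> = (\<Sum>b\<in>B. l b)"
    using sum.image_gen[OF B(4), of l l] by simp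
  also have "\<dots> = (\<Sum>b\<in>B. A b \<bullet> b)"
    using B(2) l by (intro sum.cong refl) (simp add: norm_eq_1)
  also have "\<dots> = (\<Sum>e\<in>Basis. A e \<bullet> e)"
    using sum_inner_orthonormal_basis[OF lin sa B(1,2,4,6)] .
  finally have tr: "sum_list L = (\<Sum>e\<in>Basis. A e \<bullet> e)" .
  have "L \<noteq> []"
    using len by auto
  then have snoc: "L = butlast L @ [last L]"
    by simp
  have "take N L = butlast L"
    using len by (simp add: butlast_conv_take)
  moreover have "sum_list L = sum_list (butlast L) + last L"
    by (subst snoc) (simp del: append_butlast_last_id)
  ultimately have low: "trace_low N A = (\<Sum>e\<in>Basis. A e \<bullet> e) - last L"
    using tr by (simp add: trace_low_def L_def)
  have "last L \<in> set L"
    using \<open>L \<noteq> []\<close> by simp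
  then have "last L \<in> l ` B"
    using B(4) by (auto simp: Ldef)
  then obtain b where b: "b \<in> B" "last L = l b"
    by auto
  then have "A b \<bullet> b = last L"
    using l B(2) by (simp add: norm_eq_1)
  then show ?thesis
    using that low b(1) B(2) by metis
qed

section \<open>Graphs touching an \<open>(n,h)\<close> set from above\<close>

lemma sum_Basis_power2_inner:
  fixes e :: "'a::euclidean_space"
  shows "(\<Sum>i\<in>Basis. (e \<bullet> i)\<^sup>2) = (norm e)\<^sup>2"
  unfolding power2_norm_eq_inner by (subst euclidean_inner[of e e]) (simp add: power2_eq_square)

lemma grad_eqI:
  assumes "GDERIV f x :> D"
  shows "grad f x = D"
  unfolding grad_def
proof (rule the_equality)
  show "GDERIV f x :> D"
    by (rule assms)
next
  fix D' assume "GDERIV f x :> D'"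
  then have "(\<lambda>w. w \<bullet> D') = (\<lambda>w. w \<bullet> D)"
    using assms has_derivative_unique unfolding gderiv_def by blast
  then have "(D' - D) \<bullet> (D' - D) = 0"
    by (metis inner_diff_right right_minus_eq)
  then show "D' = D"
    by simp
qed

lemma C2_on_from_derivatives:
  assumes U: "open U" and G: "\<And>y. y \<in> U \<Longrightarrow> GDERIV f y :> G y"
    and H: "\<And>y. y \<in> U \<Longrightarrow> (G has_derivative H y) (at y)"
    and cont: "\<And>v. continuous_on U (\<lambda>y. H y v)"
  shows "C2_on f U" "\<And>y. y \<in> U \<Longrightarrow> grad f y = G y" "\<And>y. y \<in> U \<Longrightarrow> hess f y = H y"
proof -
  show g: "grad f y = G y" if "y \<in> U" for y
    using G that by (simp add: grad_eqI)
  have gH: "(grad f has_derivative H y) (at y)" if "y \<in> U" for y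
    using g by (intro has_derivative_transform_within_open[OF H[OF that] U that]) simp
  show h: "hess f y = H y" if "y \<in> U" for y
    unfolding hess_def using frechet_derivative_at[OF gH[OF that]] by simp
  have "continuous_on U (\<lambda>y. hess f y v)" for v
    using cont[of v] by (rule continuous_on_eq) (simp add: h)
  then show "C2_on f U"
    unfolding C2_on_def using U G gH by (auto simp: gderiv_def differentiable_def)
qed

text \<open>
Test functions are given together with their gradient and Hessian, so that the descriptions and
choice operators in \<^const>\<open>grad\<close> and \<^const>\<open>hess\<close> have to be evaluated only once.
\<close>

definition C2_with_derivatives ::
    "('a::euclidean_space \<Rightarrow> real) \<Rightarrow> ('a \<Rightarrow> 'a) \<Rightarrow> ('a \<Rightarrow> 'a \<Rightarrow> 'a) \<Rightarrow> bool" where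
  "C2_with_derivatives \<phi> g H \<longleftrightarrow> (\<forall>y. GDERIV \<phi> y :> g y) \<and> (\<forall>y. (g has_derivative H y) (at y))
     \<and> (\<forall>v. continuous_on UNIV (\<lambda>y. H y v)) \<and> (\<forall>y v w. H y v \<bullet> w = v \<bullet> H y w)"

lemma lagrange_identity_graph_normal:
  fixes p v :: "'a::real_inner"
  assumes "(norm v)\<^sup>2 + s\<^sup>2 = 1"
  shows "(norm p)\<^sup>2 + 1 - (s - p \<bullet> v)\<^sup>2 = (norm (s *\<^sub>R p + v))\<^sup>2 + ((norm p)\<^sup>2 * (norm v)\<^sup>2 - (p \<bullet> v)\<^sup>2)"
proof -
  have "(norm (s *\<^sub>R p + v))\<^sup>2 = s\<^sup>2 * (norm p)\<^sup>2 + 2 * s * (p \<bullet> v) + (norm v)\<^sup>2"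
    unfolding power2_norm_eq_inner
    by (simp add: inner_add_left inner_add_right inner_commute[of v p] algebra_simps power2_eq_square)
  moreover have "(norm p)\<^sup>2 + 1 = ((norm p)\<^sup>2 + 1) * ((norm v)\<^sup>2 + s\<^sup>2)"
    using assms by simp
  ultimately show ?thesis
    by (simp add: algebra_simps power2_eq_square)
qed

text \<open>
For a unit vector \<open>(v, s)\<close>, the bracket on the right is \<open>|p|\<^sup>2 + 1\<close> times its squared distance from
the line normal to a graph of slope \<open>p\<close>.  If that is small, the vector is nearly normal to the graph,
hence \<open>v\<close> is not much longer than \<open>p\<close>.
\<close>

lemma normal_defect_ge:
  fixes p v :: "'a::real_inner"
  assumes "(norm v)\<^sup>2 + s\<^sup>2 = 1"
  shows "(norm v)\<^sup>2 - 2 * (norm p)\<^sup>2 \<le> 2 * ((norm p)\<^sup>2 + 1 - (s - p \<bullet> v)\<^sup>2)"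
proof -
  let ?w = "s *\<^sub>R p + v"
  have s: "s\<^sup>2 \<le> 1"
    using assms by (metis le_add_same_cancel2 zero_le_power2)
  have "norm v = norm (?w - s *\<^sub>R p)"
    by simp
  also have "\<dots> \<le> norm ?w + \<bar>s\<bar> * norm p"
    using norm_triangle_ineq4[of ?w "s *\<^sub>R p"] by simp
  finally have "(norm v)\<^sup>2 \<le> (norm ?w + \<bar>s\<bar> * norm p)\<^sup>2"
    by (simp add: power_mono)
  also have "\<dots> \<le> 2 * (norm ?w)\<^sup>2 + 2 * (\<bar>s\<bar> * norm p)\<^sup>2"
    using sum_squares_bound[of "norm ?w" "\<bar>s\<bar> * norm p"] by (simp add: power2_sum)
  also have "(\<bar>s\<bar> * norm p)\<^sup>2 \<le> (norm p)\<^sup>2"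
    using s by (simp add: power_mult_distrib mult_left_le_one_le)
  finally have "(norm v)\<^sup>2 \<le> 2 * (norm ?w)\<^sup>2 + 2 * (norm p)\<^sup>2"
    by simp
  moreover have "(p \<bullet> v)\<^sup>2 \<le> (norm p)\<^sup>2 * (norm v)\<^sup>2"
    using Cauchy_Schwarz_ineq[of p v] by (simp add: power2_norm_eq_inner)
  ultimately show ?thesis
    unfolding lagrange_identity_graph_normal[OF assms, of p] by argo
qed

text \<open>
In terms of graphs, an \<open>(n,h)\<close> set is a viscosity subsolution: if the graph of \<open>\<phi> + m\<close> touches it
from above, then \<open>\<Delta>\<phi> \<ge> - h sqrt (1 + |\<nabla>\<phi>|\<^sup>2)\<close> up to an error quadratic in the slope.  The
function \<open>t = s - \<phi>(y) - m\<close> has a local maximum on the set at the contact point, but its Hessian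
vanishes in the vertical direction, so the eigenvalue omitted by \<^const>\<open>trace_low\<close> could be one of
those of \<open>-D\<^sup>2\<phi>\<close>.  Testing with the increasing function \<open>t + L t\<^sup>2\<close> of \<open>t\<close> instead adds
\<open>2 L\<close> times the square of the normal component to the Hessian; for \<open>L\<close> at least the size of the
negative part of \<open>D\<^sup>2\<phi>\<close> this makes the normal direction the one that is omitted, up to that error.
\<close>

lemma nh_subset_touching_from_above:
  fixes \<Gamma> :: "((real ^ 'n) \<times> real) set"
  assumes nh: "nh_subset h \<Omega> \<Gamma>" and C2: "C2_with_derivatives \<phi> g H"
    and mem: "(y0, \<phi> y0 + m) \<in> \<Gamma>"
    and V: "open V" "y0 \<in> V" "\<And>y s. (y, s) \<in> \<Gamma> \<Longrightarrow> y \<in> V \<Longrightarrow> s \<le> \<phi> y + m"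
    and low: "\<And>v. - L * (norm v)\<^sup>2 \<le> H y0 v \<bullet> v" and L: "L > 0"
  shows "- (\<Sum>b\<in>Basis. H y0 b \<bullet> b) - 2 * L * (norm (g y0))\<^sup>2 \<le> h * sqrt (1 + (norm (g y0))\<^sup>2)"
proof -
  define t where "t z = snd z - \<phi> (fst z) - m" for z :: "(real ^ 'n) \<times> real"
  define F where "F z = t z + L * (t z)\<^sup>2" for z
  define G where "G z = (1 + 2 * L * t z) *\<^sub>R (- g (fst z), 1::real)" for z
  define Q where "Q z w = (2 * L * (snd w - g (fst z) \<bullet> fst w)) *\<^sub>R (- g (fst z), 1::real)
    + (1 + 2 * L * t z) *\<^sub>R (- H (fst z) (fst w), 0)" for z w
  have dphi: "(\<phi> has_derivative (\<lambda>w. w \<bullet> g y)) (at y)"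
    and dg: "(g has_derivative H y) (at y)" and Hcont: "continuous_on UNIV (\<lambda>y. H y v)"
    and Hsym: "H y v \<bullet> w = v \<bullet> H y w" for y v w
    using C2 by (auto simp: C2_with_derivatives_def gderiv_def)
  have dt: "(t has_derivative (\<lambda>w. snd w - fst w \<bullet> g (fst z))) (at z)" for z
  proof -
    have "((\<lambda>z. \<phi> (fst z)) has_derivative (\<lambda>w. fst w \<bullet> g (fst z))) (at z)"
      by (rule has_derivative_compose[OF has_derivative_fst[OF has_derivative_ident] dphi])
    then show ?thesis
      unfolding t_def by (auto intro!: derivative_eq_intros)
  qed
  have dF: "GDERIV F z :> G z" for z
    unfolding gderiv_def F_def
    by (rule derivative_eq_intros dt refl)+
      (simp add: G_def fun_eq_iff inner_prod_def algebra_simps)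
  have dgf: "((\<lambda>z. g (fst z)) has_derivative (\<lambda>w. H (fst z) (fst w))) (at z)" for z :: "(real ^ 'n) \<times> real"
    by (rule has_derivative_compose[OF has_derivative_fst[OF has_derivative_ident] dg])
  have dG: "(G has_derivative Q z) (at z)" for z
    unfolding G_def
    by (rule derivative_eq_intros dt dgf refl)+
      (simp add: Q_def fun_eq_iff inner_commute algebra_simps)
  have tcont: "continuous_on UNIV t"
    using dt by (meson continuous_at_imp_continuous_on has_derivative_continuous)
  have gcont: "continuous_on UNIV g"
    using dg by (meson continuous_at_imp_continuous_on has_derivative_continuous)
  have Qcont: "continuous_on UNIV (\<lambda>z. Q z w)" for w
    unfolding Q_def
    by (intro continuous_intros tcont continuous_on_compose2[OF gcont] continuous_on_compose2[OF Hcont]) auto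
  define z0 where "z0 = (y0, \<phi> y0 + m)"
  have t0: "t z0 = 0"
    by (simp add: t_def z0_def)
  note FF = C2_on_from_derivatives[OF open_UNIV dF dG Qcont]
  \<comment> \<open>The bound \<open>-1/L < t \<le> 0\<close> makes \<open>t + L t\<^sup>2\<close> nonpositive.\<close>
  have "\<forall>\<^sub>F z in at z0 within \<Gamma>. F z \<le> F z0"
  proof -
    have "(t \<longlongrightarrow> t z0) (at z0)"
      using has_derivative_continuous[OF dt] by (simp add: isCont_def)
    then have "\<forall>\<^sub>F z in at z0. - (1 / L) < t z"
      using L by (intro order_tendstoD) (auto simp: t0)
    then have 1: "\<forall>\<^sub>F z in at z0 within \<Gamma>. - (1 / L) < t z"
      using at_le[of \<Gamma> UNIV z0] filter_leD by blast
    have "open (fst -` V :: ((real ^ 'n) \<times> real) set)"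
      by (intro open_vimage V(1) continuous_intros)
    then have 2: "\<forall>\<^sub>F z in at z0 within \<Gamma>. z \<in> fst -` V"
      using V(2) by (intro topological_tendstoD[OF tendsto_ident_at]) (auto simp: z0_def)
    have 3: "\<forall>\<^sub>F z in at z0 within \<Gamma>. z \<in> \<Gamma>"
      by (simp add: eventually_at_filter)
    show ?thesis
      using 1 2 3
    proof eventually_elim
      case (elim z)
      then have "t z \<le> 0"
        using V(3)[of "fst z" "snd z"] by (auto simp: t_def)
      moreover have "0 \<le> 1 + L * t z"
        using elim(1) L by (simp add: field_simps)
      ultimately have "t z * (1 + L * t z) \<le> 0"
        by (simp add: mult_nonpos_nonneg)
      then show ?case
        by (simp add: F_def t0 algebra_simps power2_eq_square)
    qed
  qed
  moreover have "G z0 = (- g y0, 1)"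
    by (simp add: G_def t0) (simp add: z0_def)
  ultimately have main: "trace_low CARD('n) (Q z0) \<le> h * norm (- g y0, 1::real)"
    using nh mem FF unfolding nh_subset_def z0_def[symmetric]
    by (metis UNIV_I fst_conv prod.inject zero_neq_one zero_prod_def)
  have Q0: "Q z0 w = (2 * L * (snd w - g y0 \<bullet> fst w)) *\<^sub>R (- g y0, 1::real) + (- H y0 (fst w), 0)" for w
    by (simp add: Q_def t0) (simp add: z0_def)
  have lin: "linear (Q z0)"
    using dG has_derivative_linear by blast
  have sa: "Q z0 v \<bullet> w = v \<bullet> Q z0 w" for v w
    using Hsym[of y0 "fst w" "fst v"] by (simp add: Q0 inner_prod_def inner_commute algebra_simps)
  have qform: "Q z0 w \<bullet> w = 2 * L * (snd w - g y0 \<bullet> fst w)\<^sup>2 - H y0 (fst w) \<bullet> fst w" for w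
    by (simp add: Q0 inner_prod_def algebra_simps power2_eq_square)
  obtain \<nu> where \<nu>: "norm \<nu> = 1"
    "trace_low CARD('n) (Q z0) = (\<Sum>e\<in>Basis. Q z0 e \<bullet> e) - Q z0 \<nu> \<bullet> \<nu>"
    using trace_low_eq_trace_minus_largest[OF lin sa, of "CARD('n)"] by auto
  have H0: "H y0 0 = 0"
    using dg has_derivative_linear linear_0 by blast
  have "(norm (g y0))\<^sup>2 = (\<Sum>b\<in>Basis. (g y0 \<bullet> b)\<^sup>2)"
    by (rule sum_Basis_power2_inner[symmetric])
  then have tr: "(\<Sum>e\<in>Basis. Q z0 e \<bullet> e) = 2 * L * ((norm (g y0))\<^sup>2 + 1) - (\<Sum>b\<in>Basis. H y0 b \<bullet> b)"
    unfolding qform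
    by (subst Basis_prod_def, subst sum.union_disjoint)
      (auto simp: sum.reindex inj_on_def H0 sum_subtractf sum_distrib_left algebra_simps)
  have "norm (fst \<nu>) ^ 2 + (snd \<nu>)\<^sup>2 = 1"
    using \<nu>(1) by (simp add: norm_prod_def)
  note dfct = normal_defect_ge[OF this, of "g y0"]
  have "L * ((norm (fst \<nu>))\<^sup>2 - 2 * (norm (g y0))\<^sup>2) \<le> L * (2 * ((norm (g y0))\<^sup>2 + 1 - (snd \<nu> - g y0 \<bullet> fst \<nu>)\<^sup>2))"
    using dfct L by (intro mult_left_mono) auto
  then have "- (\<Sum>b\<in>Basis. H y0 b \<bullet> b) - 2 * L * (norm (g y0))\<^sup>2 \<le> trace_low CARD('n) (Q z0)"
    using low[of "fst \<nu>"] unfolding \<nu>(2) tr qform[of \<nu>] by (simp add: algebra_simps)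
  also have "\<dots> \<le> h * sqrt (1 + (norm (g y0))\<^sup>2)"
    using main by (simp add: norm_Pair add.commute)
  finally show ?thesis .
qed

section \<open>Comparison principle\<close>

text \<open>
The set may be unbounded from below, but only points in a bounded range of heights can compete.
\<close>

lemma highest_point_above_graph_exists:
  fixes K :: "((real ^ 'n) \<times> real) set"
  assumes K: "closed K" "K \<noteq> {}" and sub: "\<And>y s. (y, s) \<in> K \<Longrightarrow> norm y \<le> R \<and> s \<le> 0"
    and \<phi>: "continuous_on UNIV \<phi>"
  obtains y0 s0 where "(y0, s0) \<in> K" "\<And>y s. (y, s) \<in> K \<Longrightarrow> s - \<phi> y \<le> s0 - \<phi> y0"
proof -
  obtain y1 s1 where 1: "(y1, s1) \<in> K"
    using K(2) by auto
  have "compact (\<phi> ` cball 0 R)"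
    using \<phi> by (intro compact_continuous_image) (auto intro: continuous_on_subset)
  then obtain B where "\<forall>t\<in>\<phi> ` cball 0 R. norm t \<le> B"
    using compact_imp_bounded bounded_iff by metis
  then have B: "\<bar>\<phi> y\<bar> \<le> B" if "y \<in> cball 0 R" for y
    using that by auto
  let ?K = "K \<inter> (cball 0 R \<times> {s1 - 2 * B..0})"
  have "0 \<le> B"
    using B[of y1] sub[OF 1] by auto
  then have "(y1, s1) \<in> ?K"
    using 1 sub[OF 1] by auto
  moreover have "compact ?K"
    using K(1) by (intro closed_Int_compact compact_Times) auto
  moreover have "continuous_on ?K (\<lambda>z. snd z - \<phi> (fst z))"
    by (intro continuous_intros continuous_on_compose2[OF \<phi>]) auto
  ultimately obtain z0 where z0: "z0 \<in> ?K" "\<And>z. z \<in> ?K \<Longrightarrow> snd z - \<phi> (fst z) \<le> snd z0 - \<phi> (fst z0)"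
    using continuous_attains_sup[of ?K "\<lambda>z. snd z - \<phi> (fst z)"] by blast
  have "s - \<phi> y \<le> snd z0 - \<phi> (fst z0)" if "(y, s) \<in> K" for y s
  proof (cases "s1 - 2 * B \<le> s")
    case True
    then show ?thesis
      using z0(2)[of "(y, s)"] that sub[OF that] by auto
  next
    case False
    then have "s - \<phi> y \<le> s1 - \<phi> y1"
      using B[of y] B[of y1] sub[OF that] sub[OF 1] by auto
    also have "\<dots> \<le> snd z0 - \<phi> (fst z0)"
      using z0(2)[OF \<open>(y1, s1) \<in> ?K\<close>] by simp
    finally show ?thesis .
  qed
  then show ?thesis
    using that[of "fst z0" "snd z0"] z0(1) by auto
qed

lemma closedin_closure_imp_mem:
  assumes "closedin (top_of_set \<Omega>) \<Gamma>" "z \<in> closure \<Gamma>" "z \<in> \<Omega>"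
  shows "z \<in> \<Gamma>"
proof -
  obtain T where T: "closed T" "\<Gamma> = \<Omega> \<inter> T"
    using assms(1) by (auto simp: closedin_closed)
  then have "closure \<Gamma> \<subseteq> T"
    by (simp add: closure_minimal)
  then show ?thesis
    using assms T by auto
qed

text \<open>
Comparison principle: strict supersolutions \<open>\<phi>\<close> that lie above \<open>\<Gamma>\<close> on the boundary of a region
lie above it inside.  Otherwise the graph, raised by the greatest height of \<open>\<Gamma>\<close> above it, would
touch \<open>\<Gamma>\<close> at an interior point, where \<open>\<phi>\<close> fails to be a subsolution.
\<close>

lemma nh_comparison:
  fixes \<Gamma> :: "((real ^ 'n) \<times> real) set"
  assumes nh: "nh_subset h (cylinder 1) \<Gamma>" and neg: "\<Gamma> \<subseteq> {x. snd x \<le> 0}"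
    and C2: "C2_with_derivatives \<phi> g H"
    and UD: "open U" "U \<subseteq> D" "compact D" "D \<subseteq> ball 0 1"
    and L: "L > 0" and low: "\<And>y v. y \<in> U \<Longrightarrow> - L * (norm v)\<^sup>2 \<le> H y v \<bullet> v"
    and super: "\<And>y. y \<in> U \<Longrightarrow>
      (\<Sum>b\<in>Basis. H y b \<bullet> b) + 2 * L * (norm (g y))\<^sup>2 + h * sqrt (1 + (norm (g y))\<^sup>2) < 0"
    and bdry: "\<And>y s. (y, s) \<in> \<Gamma> \<Longrightarrow> y \<in> D \<Longrightarrow> y \<notin> U \<Longrightarrow> s \<le> \<phi> y"
    and mem: "(y, s) \<in> \<Gamma>" "y \<in> D"
  shows "s \<le> \<phi> y"
proof (rule ccontr)
  assume above: "\<not> s \<le> \<phi> y"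
  define K where "K = closure \<Gamma> \<inter> (D \<times> UNIV)"
  have K\<Gamma>: "z \<in> K \<longleftrightarrow> z \<in> \<Gamma> \<and> fst z \<in> D" for z
    using closedin_closure_imp_mem[of "cylinder 1" \<Gamma> z] nh UD(4) closure_subset
    by (cases z) (auto simp: K_def nh_subset_def cylinder_def subset_iff)
  have "closed K"
    unfolding K_def using UD(3) by (intro closed_Int closed_Times) (auto simp: compact_imp_closed)
  moreover have "K \<noteq> {}"
    using mem K\<Gamma>[of "(y, s)"] by auto
  moreover have "norm y \<le> 1 \<and> s \<le> 0" if "(y, s) \<in> K" for y s
    using that neg UD(4) K\<Gamma>[of "(y, s)"] by (auto simp: subset_iff less_imp_le)
  moreover have "continuous_on UNIV \<phi>"
    using C2 unfolding C2_with_derivatives_def gderiv_def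
    by (meson continuous_at_imp_continuous_on has_derivative_continuous)
  ultimately obtain y0 s0 where 0: "(y0, s0) \<in> K" and max: "\<And>y s. (y, s) \<in> K \<Longrightarrow> s - \<phi> y \<le> s0 - \<phi> y0"
    using highest_point_above_graph_exists by metis
  have y0: "(y0, s0) \<in> \<Gamma>" "y0 \<in> D"
    using 0 K\<Gamma> by auto
  have "0 < s0 - \<phi> y0"
    using max[of y s] above mem K\<Gamma>[of "(y, s)"] by auto
  then have U0: "y0 \<in> U"
    using bdry[OF y0] by force
  have "(y0, \<phi> y0 + (s0 - \<phi> y0)) \<in> \<Gamma>"
    using y0 by simp
  moreover have "s \<le> \<phi> y + (s0 - \<phi> y0)" if "(y, s) \<in> \<Gamma>" "y \<in> U" for y s
    using max[of y s] that UD(2) K\<Gamma>[of "(y, s)"] by auto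
  ultimately have "- (\<Sum>b\<in>Basis. H y0 b \<bullet> b) - 2 * L * (norm (g y0))\<^sup>2 \<le> h * sqrt (1 + (norm (g y0))\<^sup>2)"
    using nh_subset_touching_from_above[OF nh C2 _ UD(1) U0 _ low[OF U0] L] by blast
  then show False
    using super[OF U0] by linarith
qed

section \<open>Contact with paraboloids\<close>

text \<open>
The paraboloid of opening \<open>a\<close> and center \<open>x\<close> through \<open>(z, s)\<close> touches the closure of \<open>\<Gamma>\<close> from above
at that point; eliminating the constant of the paraboloid leaves a condition on differences of
squares only.
\<close>

definition contact ::
    "real \<Rightarrow> ((real ^ 'n) \<times> real) set \<Rightarrow> real ^ 'n \<Rightarrow> real ^ 'n \<Rightarrow> real \<Rightarrow> bool" where
  "contact a \<Gamma> x z s \<longleftrightarrow> (z, s) \<in> closure \<Gamma> \<and>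
     (\<forall>y \<sigma>. (y, \<sigma>) \<in> closure \<Gamma> \<longrightarrow> \<sigma> \<le> s + a / 2 * ((norm (y - x))\<^sup>2 - (norm (z - x))\<^sup>2))"

lemma touching_set_eq: "touching_set a \<Gamma> = {z. \<exists>s x. norm x \<le> 1 \<and> contact a \<Gamma> x z s}"
proof (intro equalityI subsetI)
  fix z assume "z \<in> touching_set a \<Gamma>"
  then obtain s x P t where *: "norm x \<le> 1" "\<And>y. P y = a / 2 * (norm (y - x))\<^sup>2 + t"
    "touches_from_above P (closure \<Gamma>)" "(z, s) \<in> graph P" "(z, s) \<in> closure \<Gamma>"
    unfolding touching_set_def is_paraboloid_def mem_Collect_eq Bex_def mem_cball_0 Int_iff by blast
  have "\<sigma> \<le> P y" if "(y, \<sigma>) \<in> closure \<Gamma>" for y \<sigma>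
    using *(3) that unfolding touches_from_above_def above_graph_def by force
  moreover have "s = P z"
    using *(4) by (auto simp: graph_def)
  ultimately have "contact a \<Gamma> x z s"
    unfolding contact_def using *(5) by (auto simp: *(2) algebra_simps)
  then show "z \<in> {z. \<exists>s x. norm x \<le> 1 \<and> contact a \<Gamma> x z s}"
    using *(1) by auto
next
  fix z assume "z \<in> {z. \<exists>s x. norm x \<le> 1 \<and> contact a \<Gamma> x z s}"
  then obtain s x where *: "norm x \<le> 1" "(z, s) \<in> closure \<Gamma>"
     "\<And>y \<sigma>. (y, \<sigma>) \<in> closure \<Gamma> \<Longrightarrow> \<sigma> \<le> s + a / 2 * ((norm (y - x))\<^sup>2 - (norm (z - x))\<^sup>2)"
    by (auto simp: contact_def)
  define t where "t = s - a / 2 * (norm (z - x))\<^sup>2"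
  define P where "P y = a / 2 * (norm (y - x))\<^sup>2 + t" for y
  have gr: "(z, s) \<in> graph P"
    by (auto simp: graph_def P_def t_def)
  have "continuous_on UNIV P"
    unfolding P_def by (intro continuous_intros)
  moreover have "above_graph P \<inter> closure \<Gamma> = {}"
  proof (rule ccontr)
    assume "above_graph P \<inter> closure \<Gamma> \<noteq> {}"
    then obtain y \<sigma> where "P y < \<sigma>" "(y, \<sigma>) \<in> closure \<Gamma>"
      by (auto simp: above_graph_def)
    then show False
      using *(3)[of y \<sigma>] by (simp add: P_def t_def algebra_simps)
  qed
  ultimately have "touches_from_above P (closure \<Gamma>)"
    using gr *(2) by (auto simp: touches_from_above_def)
  moreover have "is_paraboloid a x P"
    by (auto simp: is_paraboloid_def P_def)
  ultimately show "z \<in> touching_set a \<Gamma>"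
    unfolding touching_set_def mem_Collect_eq Bex_def mem_cball_0 Int_iff using gr *(1,2) by blast
qed

lemma power2_norm_diff_diff:
  fixes x y z :: "'a::real_inner"
  shows "(norm (y - x))\<^sup>2 - (norm (z - x))\<^sup>2 = y \<bullet> y - z \<bullet> z - 2 * ((y - z) \<bullet> x)"
  unfolding power2_norm_eq_inner
  by (simp add: inner_diff_left inner_diff_right inner_commute[of x y] inner_commute[of x z] algebra_simps)

text \<open>
The sum of two paraboloids is, up to a constant, the paraboloid with the sum of the openings and the
weighted mean of the centers.
\<close>

lemma paraboloid_sum:
  fixes x y z \<xi> w :: "'a::real_inner"
  assumes "(a + c) *\<^sub>R w = a *\<^sub>R x + c *\<^sub>R \<xi>"
  shows "(a + c) * ((norm (y - w))\<^sup>2 - (norm (z - w))\<^sup>2)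
    = a * ((norm (y - x))\<^sup>2 - (norm (z - x))\<^sup>2) + c * ((norm (y - \<xi>))\<^sup>2 - (norm (z - \<xi>))\<^sup>2)"
proof -
  have "(a + c) * ((y - z) \<bullet> w) = (y - z) \<bullet> ((a + c) *\<^sub>R w)"
    by simp
  also have "\<dots> = a * ((y - z) \<bullet> x) + c * ((y - z) \<bullet> \<xi>)"
    unfolding assms by (simp add: inner_add_right)
  finally show ?thesis
    unfolding power2_norm_diff_diff by (simp add: algebra_simps)
qed

context
  fixes \<Gamma> :: "((real ^ 'n) \<times> real) set"
  assumes cyl: "\<Gamma> \<subseteq> cylinder 1" and neg: "\<Gamma> \<subseteq> {x. snd x \<le> 0}"
begin

lemma closure_bounds:
  assumes "(y, s) \<in> closure \<Gamma>"
  shows "norm y \<le> 1" "s \<le> 0"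
proof -
  have "closed {z :: (real ^ 'n) \<times> real. norm (fst z) \<le> 1}" "closed {z :: (real ^ 'n) \<times> real. snd z \<le> 0}"
    by (intro closed_Collect_le continuous_intros)+
  moreover have "\<Gamma> \<subseteq> {z. norm (fst z) \<le> 1}"
    using cyl by (auto simp: cylinder_def less_imp_le)
  ultimately have "closure \<Gamma> \<subseteq> {z. norm (fst z) \<le> 1}" "closure \<Gamma> \<subseteq> {z. snd z \<le> 0}"
    using neg by (simp_all only: closure_minimal)
  then show "norm y \<le> 1" "s \<le> 0"
    using assms by auto
qed

lemma contact_exists:
  assumes "\<Gamma> \<noteq> {}"
  obtains z s where "contact a \<Gamma> x z s"
proof -
  have "continuous_on UNIV (\<lambda>y. a / 2 * (norm (y - x))\<^sup>2)"
    by (intro continuous_intros)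
  then obtain z s where "(z, s) \<in> closure \<Gamma>"
    "\<And>y \<sigma>. (y, \<sigma>) \<in> closure \<Gamma> \<Longrightarrow> \<sigma> - a / 2 * (norm (y - x))\<^sup>2 \<le> s - a / 2 * (norm (z - x))\<^sup>2"
    using highest_point_above_graph_exists[of "closure \<Gamma>" 1 "\<lambda>y. a / 2 * (norm (y - x))\<^sup>2"]
      assms closure_bounds by (metis closed_closure closure_eq_empty)
  then have "contact a \<Gamma> x z s"
    by (auto simp: contact_def algebra_simps)
  then show ?thesis
    by (rule that)
qed

text \<open>
The set is a projection of the closed set of triples (center, contact point), which is bounded
because a paraboloid with center in the unit ball that lies above one given point of the closure
cannot meet it far below that point.
\<close>

lemma compact_touching_set:
  assumes "0 \<le> a"
  shows "compact (touching_set a \<Gamma>)"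
proof (cases "\<Gamma> = {}")
  case True
  then show ?thesis
    by (simp add: touching_set_eq contact_def)
next
  case False
  then obtain y1 s1 where 1: "(y1, s1) \<in> closure \<Gamma>"
    using closure_subset by fastforce
  define W where "W = {p :: (real ^ 'n) \<times> (real ^ 'n) \<times> real.
    norm (fst p) \<le> 1 \<and> contact a \<Gamma> (fst p) (fst (snd p)) (snd (snd p))}"
  have "W = {p. norm (fst p) \<le> 1} \<inter> snd -` closure \<Gamma> \<inter> (\<Inter>(y, \<sigma>)\<in>closure \<Gamma>.
      {p. \<sigma> \<le> snd (snd p) + a / 2 * ((norm (y - fst p))\<^sup>2 - (norm (fst (snd p) - fst p))\<^sup>2)})"
    by (auto simp: W_def contact_def)
  moreover have "closed {p :: (real ^ 'n) \<times> (real ^ 'n) \<times> real. norm (fst p) \<le> 1}"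
    by (intro closed_Collect_le continuous_intros)
  moreover have "closed {p :: (real ^ 'n) \<times> (real ^ 'n) \<times> real.
     \<sigma> \<le> snd (snd p) + a / 2 * ((norm (y - fst p))\<^sup>2 - (norm (fst (snd p) - fst p))\<^sup>2)}" for y \<sigma>
    by (intro closed_Collect_le continuous_intros)
  moreover have "closed (snd -` closure \<Gamma> :: ((real ^ 'n) \<times> (real ^ 'n) \<times> real) set)"
    by (intro closed_vimage closed_closure continuous_intros)
  ultimately have "closed W"
    by (auto intro!: closed_Int closed_INT)
  moreover have "W \<subseteq> cball 0 1 \<times> cball 0 1 \<times> {s1 - 2 * a..0}"
  proof
    fix p assume p: "p \<in> W"
    obtain x z s where xzs: "p = (x, z, s)"
      by (cases p)
    have *: "norm x \<le> 1" "(z, s) \<in> closure \<Gamma>"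
      "s1 \<le> s + a / 2 * ((norm (y1 - x))\<^sup>2 - (norm (z - x))\<^sup>2)"
      using p 1 by (auto simp: W_def xzs contact_def)
    have "norm (y1 - x) \<le> 2"
      using norm_triangle_ineq4[of y1 x] *(1) closure_bounds[OF 1] by linarith
    then have "(norm (y1 - x))\<^sup>2 \<le> 2\<^sup>2"
      by (rule power_mono) simp
    then have "a / 2 * ((norm (y1 - x))\<^sup>2 - (norm (z - x))\<^sup>2) \<le> a / 2 * 4"
      using assms by (intro mult_left_mono) (simp_all add: diff_le_eq add_increasing2)
    then show "p \<in> cball 0 1 \<times> cball 0 1 \<times> {s1 - 2 * a..0}"
      using * closure_bounds[OF *(2)] by (simp add: xzs)
  qed
  moreover have "compact (cball (0::real ^ 'n) 1 \<times> cball (0::real ^ 'n) 1 \<times> {s1 - 2 * a..0})"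
    by (intro compact_Times compact_cball compact_Icc)
  ultimately have "compact W"
    by (metis closed_Int_compact inf.absorb1)
  then have "compact ((fst \<circ> snd) ` W)"
    by (intro compact_continuous_image continuous_intros) (auto simp: comp_def intro!: continuous_intros)
  moreover have "touching_set a \<Gamma> = (fst \<circ> snd) ` W"
    by (auto simp: touching_set_eq W_def image_iff) blast
  ultimately show ?thesis
    by simp
qed

text \<open>
Adding the paraboloid of opening \<open>b - a\<close> centered at the contact point \<open>z\<close> keeps the contact, and
moves the center \<open>x\<close> towards \<open>z\<close>, hence not out of the unit ball.
\<close>

lemma touching_set_mono:
  assumes "0 < a" "a \<le> b"
  shows "touching_set a \<Gamma> \<subseteq> touching_set b \<Gamma>"
proof
  fix z assume "z \<in> touching_set a \<Gamma>"
  then obtain s x where x: "norm x \<le> 1" "contact a \<Gamma> x z s"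
    by (auto simp: touching_set_eq)
  then have z: "norm z \<le> 1"
    using closure_bounds by (auto simp: contact_def)
  define w where "w = (a / b) *\<^sub>R x + (1 - a / b) *\<^sub>R z"
  have "norm w \<le> (a / b) * norm x + (1 - a / b) * norm z"
    unfolding w_def using assms by (intro norm_triangle_le) simp
  also have "\<dots> \<le> (a / b) * 1 + (1 - a / b) * 1"
    using assms x(1) z by (intro add_mono mult_left_mono) auto
  finally have "norm w \<le> 1"
    by simp
  moreover have "contact b \<Gamma> w z s"
    unfolding contact_def
  proof (intro conjI allI impI)
    show "(z, s) \<in> closure \<Gamma>"
      using x(2) by (simp add: contact_def)
    fix y \<sigma> assume "(y, \<sigma>) \<in> closure \<Gamma>"
    then have "\<sigma> \<le> s + a / 2 * ((norm (y - x))\<^sup>2 - (norm (z - x))\<^sup>2)"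
      using x(2) by (simp add: contact_def)
    moreover have "(a + (b - a)) *\<^sub>R w = a *\<^sub>R x + (b - a) *\<^sub>R z"
      using assms by (simp add: w_def algebra_simps)
    note paraboloid_sum[OF this, of y z]
    moreover have "0 \<le> (b - a) * (norm (y - z))\<^sup>2"
      using assms by simp
    ultimately show "\<sigma> \<le> s + b / 2 * ((norm (y - w))\<^sup>2 - (norm (z - w))\<^sup>2)"
      by (simp add: add_divide_distrib)
  qed
  ultimately show "z \<in> touching_set b \<Gamma>"
    by (auto simp: touching_set_eq)
qed

end

section \<open>Centers of touching paraboloids as Lipschitz functions of the contact points\<close>

lemma power2_inner_le: "(e \<bullet> v)\<^sup>2 \<le> (norm e)\<^sup>2 * (norm v)\<^sup>2"
  using Cauchy_Schwarz_ineq[of e v] by (simp add: power2_norm_eq_inner)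

lemma has_derivative_power2_norm_diff:
  "((\<lambda>y. (norm (y - x))\<^sup>2) has_derivative (\<lambda>w. 2 * (w \<bullet> (y - x)))) (at y)"
  unfolding power2_norm_eq_inner
  by (auto intro!: derivative_eq_intros simp: inner_commute)

lemma contact_mem:
  assumes "nh_subset h (cylinder 1) \<Gamma>" "contact a \<Gamma> x z s" "norm z < 1"
  shows "(z, s) \<in> \<Gamma>"
  using assms closedin_closure_imp_mem[of "cylinder 1" \<Gamma> "(z, s)"]
  by (auto simp: nh_subset_def contact_def cylinder_def)

lemma contact_above:
  assumes "contact a \<Gamma> x z s" "(y, \<sigma>) \<in> \<Gamma>"
  shows "\<sigma> \<le> s + a / 2 * ((norm (y - x))\<^sup>2 - (norm (z - x))\<^sup>2)"
  using assms closure_subset unfolding contact_def by blast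

lemma sqrt_one_plus_le_two: "g \<le> 1 \<Longrightarrow> sqrt (1 + g) \<le> 2"
  by (intro real_le_lsqrt) auto

text \<open>
Let \<open>P\<close> touch at \<open>z0\<close> with center \<open>x0\<close>, and put \<open>\<zeta> y = e \<bullet> (y - z0)\<close> where \<open>e\<close> is the direction of
\<open>x0 - x1\<close>.  The two paraboloids differ by an affine function with gradient \<open>b (x0 - x1)\<close>, so if the
centers are far apart, \<open>\<Gamma>\<close> lies well below \<open>P\<close> on the side \<open>\<zeta> = -2 d\<close>.  This depth compensates for
a correction of \<open>P\<close> that is strongly concave in the direction \<open>e\<close>, negative at \<open>z0\<close>, and nonnegative
on the rest of the boundary of a region around \<open>z0\<close>.  The comparison principle then pushes \<open>\<Gamma>\<close>
strictly below \<open>P\<close> at \<open>z0\<close>, contradicting the contact.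
\<close>

lemma contact_centers_close_at_scale:
  fixes \<Gamma> :: "((real ^ 'n) \<times> real) set"
  defines "n \<equiv> real CARD('n)"
  assumes nh: "nh_subset h (cylinder 1) \<Gamma>" and neg: "\<Gamma> \<subseteq> {x. snd x \<le> 0}"
    and c0: "contact b \<Gamma> x0 z0 s0" "norm x0 \<le> 1" "norm z0 \<le> 1 / 3"
    and c1: "contact b \<Gamma> x1 z1 s1"
    and b: "0 < b" "b \<le> 1 / 20" "h \<le> b"
    and d: "0 < d" "14 * n * d \<le> 1" "norm (z1 - z0) \<le> d"
  shows "norm (x1 - x0) \<le> 36 * n * d"
proof (rule ccontr)
  assume far: "\<not> norm (x1 - x0) \<le> 36 * n * d"
  have n1: "1 \<le> n"
    unfolding n_def using zero_less_card_finite[where 'a = 'n] by linarith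
  have h0: "0 \<le> h"
    using nh by (simp add: nh_subset_def)
  define v where "v = x0 - x1"
  have v: "36 * n * d < norm v"
    using far by (simp add: v_def norm_minus_commute)
  have "0 < n * d"
    using n1 d by simp
  then have v0: "0 < norm v"
    using v by linarith
  define e where "e = (1 / norm v) *\<^sub>R v"
  have e: "norm e = 1" and ve: "v = norm v *\<^sub>R e"
    using v0 by (auto simp: e_def)
  define \<zeta> where "\<zeta> y = e \<bullet> (y - z0)" for y
  define P where "P y = s0 + b / 2 * ((norm (y - x0))\<^sup>2 - (norm (z0 - x0))\<^sup>2)" for y
  \<comment> \<open>Transversally to \<open>e\<close> the correction grows like \<open>b |y - z0|\<^sup>2\<close>; along \<open>e\<close> it is
    \<open>- 4 n b (\<zeta> - d)\<^sup>2\<close>, where \<open>4 n\<close> outweighs the Laplacians of all the other terms.  The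
    region below has radius \<open>7 n d\<close> so that the growth prevails where \<open>\<zeta>\<close> is between \<open>-2 d\<close> and \<open>d\<close>.\<close>
  define \<phi> where "\<phi> y = P y + b * (norm (y - z0))\<^sup>2 - b * (\<zeta> y)\<^sup>2 - 4 * n * b * (\<zeta> y - d)\<^sup>2" for y
  define g where "g y = b *\<^sub>R (y - x0) + (2 * b) *\<^sub>R (y - z0) - (2 * b * \<zeta> y + 8 * n * b * (\<zeta> y - d)) *\<^sub>R e" for y
  define H where "H y w = (3 * b) *\<^sub>R w - ((2 * b + 8 * n * b) * (e \<bullet> w)) *\<^sub>R e" for y w :: "real ^ 'n"
  have d\<zeta>: "(\<zeta> has_derivative (\<lambda>w. w \<bullet> e)) (at y)" for y
    unfolding \<zeta>_def by (auto intro!: derivative_eq_intros simp: inner_commute)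
  have "GDERIV \<phi> y :> g y" for y
  proof -
    have wg: "w \<bullet> g y = b * (w \<bullet> (y - x0)) + 2 * b * (w \<bullet> (y - z0))
        - (2 * b * \<zeta> y + 8 * n * b * (\<zeta> y - d)) * (w \<bullet> e)" for w
      unfolding g_def inner_diff_right[of w "_ + _"] inner_add_right inner_scaleR_right ..
    define N where "N x y = (norm (y - x))\<^sup>2" for x y :: "real ^ 'n"
    have dN: "(N x has_derivative (\<lambda>w. 2 * (w \<bullet> (y - x)))) (at y)" for x y
      unfolding N_def by (rule has_derivative_power2_norm_diff)
    have "\<phi> = (\<lambda>y. s0 + b / 2 * (N x0 y - N x0 z0) + b * N z0 y - b * (\<zeta> y)\<^sup>2 - 4 * n * b * (\<zeta> y - d)\<^sup>2)"
      by (simp add: fun_eq_iff \<phi>_def P_def N_def)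
    then have "(\<phi> has_derivative (\<lambda>w. b / 2 * (2 * (w \<bullet> (y - x0))) + b * (2 * (w \<bullet> (y - z0)))
        - b * (2 * \<zeta> y * (w \<bullet> e)) - 4 * n * b * (2 * (\<zeta> y - d) * (w \<bullet> e)))) (at y)"
      by (auto intro!: derivative_eq_intros dN d\<zeta>)
    then show ?thesis
      unfolding gderiv_def wg by (rule has_derivative_eq_rhs) (simp add: fun_eq_iff distrib_right)
  qed
  moreover have "(g has_derivative H y) (at y)" for y
  proof -
    have "(g has_derivative (\<lambda>w. b *\<^sub>R w + (2 * b) *\<^sub>R w - (2 * b * (w \<bullet> e) + 8 * n * b * (w \<bullet> e)) *\<^sub>R e)) (at y)"
      unfolding g_def by (auto intro!: derivative_eq_intros d\<zeta>)
    then show ?thesis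
    proof (rule has_derivative_eq_rhs)
      have "b *\<^sub>R w + (2 * b) *\<^sub>R w = (3 * b) *\<^sub>R w" for w :: "real ^ 'n"
        by (simp flip: scaleR_left_distrib)
      then show "(\<lambda>w. b *\<^sub>R w + (2 * b) *\<^sub>R w - (2 * b * (w \<bullet> e) + 8 * n * b * (w \<bullet> e)) *\<^sub>R e) = H y"
        by (simp add: H_def fun_eq_iff inner_commute[of e] distrib_right)
    qed
  qed
  moreover have "continuous_on UNIV (\<lambda>y. H y w)" for w
    by (simp add: H_def)
  moreover have "H y u \<bullet> w = u \<bullet> H y w" for y u w
    by (simp add: H_def inner_diff_left inner_diff_right inner_commute)
  ultimately have C2: "C2_with_derivatives \<phi> g H"
    by (simp add: C2_with_derivatives_def)
  define D where "D = cball z0 (7 * n * d) \<inter> {y. - 2 * d \<le> \<zeta> y \<and> \<zeta> y \<le> d}"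
  define U where "U = ball z0 (7 * n * d) \<inter> {y. - 2 * d < \<zeta> y \<and> \<zeta> y < d}"
  have \<zeta>_cont: "continuous_on UNIV \<zeta>"
    unfolding \<zeta>_def by (intro continuous_intros)
  have "open U" "U \<subseteq> D" "compact D"
  proof -
    show "open U"
      unfolding U_def by (intro open_Int open_ball open_Collect_conj open_Collect_less continuous_intros \<zeta>_cont)
    show "compact D"
      unfolding D_def by (intro compact_Int_closed compact_cball closed_Collect_conj closed_Collect_le continuous_intros \<zeta>_cont)
  qed (auto simp: U_def D_def)
  have D1: "norm y < 1" if "y \<in> D" for y
  proof -
    have "norm y \<le> norm z0 + norm (y - z0)"
      using norm_triangle_ineq[of z0 "y - z0"] by simp
    moreover have "norm (y - z0) \<le> 7 * n * d"
      using that by (simp add: D_def dist_norm norm_minus_commute)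
    ultimately show ?thesis
      using c0(3) d(2) by linarith
  qed
  then have "D \<subseteq> ball 0 1"
    by auto
  \<comment> \<open>The slopes are of order \<open>b\<close>, which makes the gradient terms of higher order than
    \<open>\<Delta>\<phi> = - (5 n + 2) b\<close>.\<close>
  have gb: "norm (g y) \<le> 5 * b" if y: "y \<in> U" for y
  proof -
    have 1: "norm (y - x0) \<le> 2"
      using norm_triangle_ineq4[of y x0] D1[of y] \<open>U \<subseteq> D\<close> y c0(2) by force
    have 2: "norm (y - z0) \<le> 1 / 2"
      using y d(2) by (simp add: U_def dist_norm norm_minus_commute)
    have dn: "d \<le> n * d"
      using n1 d(1) by simp
    have 3: "\<bar>\<zeta> y\<bar> \<le> 2 * d" "\<bar>\<zeta> y - d\<bar> \<le> 3 * d"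
      using y d(1) by (auto simp: U_def)
    have "\<bar>2 * b * \<zeta> y + 8 * n * b * (\<zeta> y - d)\<bar> \<le> 2 * b * \<bar>\<zeta> y\<bar> + 8 * n * b * \<bar>\<zeta> y - d\<bar>"
      using b n1 by (intro order_trans[OF abs_triangle_ineq]) (simp add: abs_mult)
    also have "\<dots> \<le> 2 * b * (2 * d) + 8 * n * b * (3 * d)"
      using 3 b n1 by (intro add_mono mult_left_mono) auto
    also have "\<dots> = b * (4 * d + 24 * (n * d))"
      by (simp add: algebra_simps)
    also have "\<dots> \<le> b * 2"
      using b d(2) dn by (intro mult_left_mono) auto
    finally have 4: "norm ((2 * b * \<zeta> y + 8 * n * b * (\<zeta> y - d)) *\<^sub>R e) \<le> b * 2"
      by (simp add: e)
    have "norm (g y) \<le> norm (b *\<^sub>R (y - x0)) + norm ((2 * b) *\<^sub>R (y - z0))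
        + norm ((2 * b * \<zeta> y + 8 * n * b * (\<zeta> y - d)) *\<^sub>R e)"
      unfolding g_def by (intro order_trans[OF norm_triangle_ineq4] add_mono norm_triangle_ineq order_refl)
    also have "\<dots> \<le> b * 2 + 2 * b * (1 / 2) + b * 2"
      using 1 2 4 b by (intro add_mono) auto
    finally show ?thesis
      by simp
  qed
  have tr: "(\<Sum>i\<in>Basis. H y i \<bullet> i) = 3 * b * n - (2 * b + 8 * n * b)" for y
  proof -
    have "(\<Sum>i\<in>Basis. H y i \<bullet> i) = (\<Sum>i\<in>Basis. 3 * b - (2 * b + 8 * n * b) * (e \<bullet> i)\<^sup>2)"
      by (intro sum.cong refl) (simp add: H_def inner_diff_left power2_eq_square)
    then show ?thesis
      by (simp add: sum_subtractf sum_distrib_left[symmetric] sum_Basis_power2_inner e n_def)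
  qed
  have bnd: "3 * b * n - (2 * b + 8 * n * b) + 2 * (8 * n * b) * (norm (g y))\<^sup>2
      + h * sqrt (1 + (norm (g y))\<^sup>2) < 0" if "y \<in> U" for y
  proof -
    have "(norm (g y))\<^sup>2 \<le> (5 * b)\<^sup>2"
      using gb[OF that] by (intro power_mono) auto
    also have "\<dots> \<le> (5 * (1 / 20))\<^sup>2"
      using b by (intro power_mono) auto
    finally have g2: "(norm (g y))\<^sup>2 \<le> 1 / 16"
      by (simp add: power2_eq_square)
    have "h * sqrt (1 + (norm (g y))\<^sup>2) \<le> b * 2"
      using g2 h0 b by (intro mult_mono sqrt_one_plus_le_two) auto
    moreover have "2 * (8 * n * b) * (norm (g y))\<^sup>2 \<le> 2 * (8 * n * b) * (1 / 16)"
      using g2 n1 b by (intro mult_left_mono) auto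
    moreover have "0 < n * b"
      using n1 b by simp
    ultimately show ?thesis
      by (simp add: algebra_simps)
  qed
  have low: "- (8 * n * b) * (norm w)\<^sup>2 \<le> H y w \<bullet> w" for y w
  proof -
    have "H y w \<bullet> w = 3 * b * (norm w)\<^sup>2 - (2 * b + 8 * n * b) * (e \<bullet> w)\<^sup>2"
      by (simp add: H_def inner_diff_left power2_norm_eq_inner) (simp add: power2_eq_square)
    moreover have "(2 * b + 8 * n * b) * (e \<bullet> w)\<^sup>2 \<le> (2 * b + 8 * n * b) * (norm w)\<^sup>2"
      using power2_inner_le[of e w] e b n1 by (intro mult_left_mono) auto
    moreover have "0 \<le> b * (norm w)\<^sup>2"
      using b by simp
    ultimately show ?thesis
      by (simp add: algebra_simps)
  qed
  have bdry: "s \<le> \<phi> y" if "(y, s) \<in> \<Gamma>" "y \<in> D" "y \<notin> U" for y s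
  proof -
    have sP: "s \<le> P y"
      using contact_above[OF c0(1) that(1)] by (simp add: P_def)
    have \<zeta>: "- 2 * d \<le> \<zeta> y" "\<zeta> y \<le> d"
      using that(2) by (auto simp: D_def)
    have \<zeta>y: "(\<zeta> y)\<^sup>2 \<le> (norm (y - z0))\<^sup>2"
      using power2_inner_le[of e "y - z0"] e by (simp add: \<zeta>_def)
    have "norm (y - z0) \<le> 7 * n * d" "\<not> (norm (y - z0) < 7 * n * d \<and> - 2 * d < \<zeta> y \<and> \<zeta> y < d)"
      using that(2,3) by (auto simp: U_def D_def dist_norm norm_minus_commute)
    then consider "norm (y - z0) = 7 * n * d" | "\<zeta> y = d" | "\<zeta> y = - 2 * d"
      using \<zeta> by linarith
    then show ?thesis
    proof cases
      case 1
      have "(\<zeta> y)\<^sup>2 \<le> (2 * d)\<^sup>2" "(\<zeta> y - d)\<^sup>2 \<le> (3 * d)\<^sup>2"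
        using \<zeta> d(1) by (intro iffD1[OF abs_le_square_iff]; simp)+
      then have "b * (\<zeta> y)\<^sup>2 + 4 * n * b * (\<zeta> y - d)\<^sup>2 \<le> b * (2 * d)\<^sup>2 + 4 * n * b * (3 * d)\<^sup>2"
        using b n1 by (intro add_mono mult_left_mono) auto
      also have "\<dots> = (4 + 36 * n) * (b * d\<^sup>2)"
        by (simp add: algebra_simps power2_eq_square)
      also have "\<dots> \<le> (49 * n\<^sup>2) * (b * d\<^sup>2)"
      proof (intro mult_right_mono)
        have "n \<le> n\<^sup>2"
          using n1 by (simp add: power2_eq_square)
        then show "4 + 36 * n \<le> 49 * n\<^sup>2"
          using n1 by linarith
      qed (use b in auto)
      also have "\<dots> = b * (norm (y - z0))\<^sup>2"
        unfolding 1 by (simp add: power_mult_distrib)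
      finally show ?thesis
        using sP by (simp add: \<phi>_def)
    next
      case 2
      have "b * (\<zeta> y)\<^sup>2 \<le> b * (norm (y - z0))\<^sup>2"
        using \<zeta>y b by (intro mult_left_mono) auto
      then show ?thesis
        using sP by (simp add: \<phi>_def 2)
    next
      case 3
      have "s \<le> s1 + b / 2 * ((norm (y - x1))\<^sup>2 - (norm (z1 - x1))\<^sup>2)"
        by (rule contact_above[OF c1 that(1)])
      also have "s1 \<le> P z1"
        using c0(1) c1 by (simp add: contact_def P_def)
      also have "P z1 + b / 2 * ((norm (y - x1))\<^sup>2 - (norm (z1 - x1))\<^sup>2) = P y + b * ((y - z1) \<bullet> v)"
        unfolding P_def v_def power2_norm_diff_diff inner_diff_right[of "y - z1"]
        using power2_norm_diff_diff[of y x0 z1] by (simp add: algebra_simps add_divide_distrib diff_divide_distrib)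
      also have "(y - z1) \<bullet> v = norm v * (\<zeta> y - \<zeta> z1)"
        by (subst ve) (simp add: \<zeta>_def inner_diff_left inner_diff_right inner_commute)
      also have "norm v * (\<zeta> y - \<zeta> z1) \<le> norm v * (- d)"
      proof (rule mult_left_mono)
        have "\<bar>\<zeta> z1\<bar> \<le> d"
          using Cauchy_Schwarz_ineq2[of e "z1 - z0"] e d(3) by (simp add: \<zeta>_def)
        then show "\<zeta> y - \<zeta> z1 \<le> - d"
          using 3 by linarith
      qed simp
      also have "norm v * (- d) \<le> (36 * n * d) * (- d)"
        using v d(1) by (intro mult_right_mono_neg) auto
      finally have "s \<le> P y - 36 * n * b * d\<^sup>2"
        using b by (simp add: algebra_simps power2_eq_square)
      moreover have "b * (\<zeta> y)\<^sup>2 \<le> b * (norm (y - z0))\<^sup>2"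
        using \<zeta>y b by (intro mult_left_mono) auto
      moreover have "4 * n * b * (\<zeta> y - d)\<^sup>2 = 36 * n * b * d\<^sup>2"
        by (simp add: 3 power2_eq_square)
      ultimately show ?thesis
        unfolding \<phi>_def by linarith
    qed
  qed
  have "(z0, s0) \<in> \<Gamma>"
    using contact_mem[OF nh c0(1)] c0(3) by simp
  moreover have "z0 \<in> D"
    using d(1) n1 by (simp add: D_def \<zeta>_def)
  moreover have "0 < 8 * n * b"
    using n1 b by simp
  ultimately have "s0 \<le> \<phi> z0"
    using nh_comparison[OF nh neg C2 \<open>open U\<close> \<open>U \<subseteq> D\<close> \<open>compact D\<close> \<open>D \<subseteq> ball 0 1\<close> _ low _ bdry]
      bnd unfolding tr by blast
  moreover have "\<phi> z0 = s0 - 4 * n * b * d\<^sup>2"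
    by (simp add: \<phi>_def P_def \<zeta>_def)
  moreover have "0 < 4 * n * b * d\<^sup>2"
    using n1 b d by simp
  ultimately show False
    by linarith
qed

section \<open>Propagation of contact to nearby balls\<close>

text \<open>
The inverse of the value \<open>exp (- A R\<^sup>2)\<close> that the barrier below, with \<open>A = 256 n / r\<^sup>2\<close>, takes on the
outer sphere of radius \<open>R = 3 r / 4\<close>.
\<close>

definition barrier_depth :: "real \<Rightarrow> real" where
  "barrier_depth n = exp (144 * n)"

text \<open>
Times the cube of the opening, this bounds the error term \<open>2 L |\<nabla>\<phi>|\<^sup>2\<close> of the comparison principle
for the barrier below.  For openings up to its inverse the error is at most the opening.
\<close>

definition barrier_size :: "real \<Rightarrow> real" where
  "barrier_size n = 8 * (256 * n)\<^sup>2 * barrier_depth n * (2 + 256 * n * barrier_depth n)\<^sup>2"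

text \<open>
A paraboloid that touches \<open>\<Gamma>\<close> at one point is nearly attained in every ball of comparable size in
the vicinity.  If \<open>\<Gamma>\<close> were more than \<open>const * a r\<^sup>2\<close> below it over the ball of radius \<open>r / 16\<close> around
\<open>c\<close>, one could subtract a multiple of \<open>exp (- A |y - c|\<^sup>2)\<close>, corrected by a constant so as to vanish
for \<open>|y - c| = 3 r / 4\<close>.  For large \<open>A\<close> the Laplacian of this Gaussian is so large on the annulus that
the result is a strict supersolution there.  The comparison principle then keeps \<open>\<Gamma>\<close> below it, and
thus strictly below the paraboloid at the contact point.
\<close>

lemma nearby_point_of_contact:
  fixes \<Gamma> :: "((real ^ 'n) \<times> real) set"
  defines "n \<equiv> real CARD('n)"
  assumes nh: "nh_subset h (cylinder 1) \<Gamma>" and neg: "\<Gamma> \<subseteq> {x. snd x \<le> 0}"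
    and c0: "contact a \<Gamma> x0 z0 s0" "norm x0 \<le> 1"
    and a: "0 < a" "a * barrier_size n \<le> 1" "h \<le> a"
    and c: "norm c \<le> 1 / 3" "0 < r" "r \<le> 2 / 3" "norm (z0 - c) \<le> 5 / 8 * r"
  obtains y s where "(y, s) \<in> \<Gamma>" "norm (y - c) \<le> r / 16"
    "s0 + a / 2 * ((norm (y - x0))\<^sup>2 - (norm (z0 - x0))\<^sup>2) - barrier_depth n * a * r\<^sup>2 \<le> s"
proof (rule ccontr)
  assume no: "\<not> thesis"
  note witness = that
  define P where "P y = s0 + a / 2 * ((norm (y - x0))\<^sup>2 - (norm (z0 - x0))\<^sup>2)" for y
  define q where "q = barrier_depth n"
  have low_near: "s < P y - q * a * r\<^sup>2" if "(y, s) \<in> \<Gamma>" "norm (y - c) \<le> r / 16" for y s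
    using no witness[OF that] unfolding P_def q_def by linarith
  have n1: "1 \<le> n"
    unfolding n_def using zero_less_card_finite[where 'a = 'n] by linarith
  have h0: "0 \<le> h"
    using nh by (simp add: nh_subset_def)
  have q1: "1 \<le> q"
    using n1 by (simp add: q_def barrier_depth_def)
  \<comment> \<open>Relative to its value, the Gaussian has Laplacian \<open>4 A\<^sup>2 |y - c|\<^sup>2 - 2 n A\<close>, and
    \<open>4 A\<^sup>2 |y - c|\<^sup>2 \<ge> 4 n A\<close> for \<open>|y - c| \<ge> r / 16\<close>.\<close>
  define A where "A = 256 * n / r\<^sup>2"
  define Q where "Q = q * a * r\<^sup>2"
  have A0: "0 < A" and Q0: "0 < Q"
    using n1 a c q1 by (simp_all add: A_def Q_def)
  have Ar: "A * r\<^sup>2 = 256 * n"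
    using c(2) by (simp add: A_def)
  have AQ: "A * Q = 256 * n * q * a"
    using c(2) by (simp add: A_def Q_def)
  define \<epsilon> where "\<epsilon> y = exp (- (A * (norm (y - c))\<^sup>2))" for y
  define \<epsilon>0 where "\<epsilon>0 = exp (- (144 * n))"
  have \<epsilon>0: "\<epsilon>0 < \<epsilon> y" if "norm (y - c) < 3 / 4 * r" for y
  proof -
    have "(norm (y - c))\<^sup>2 < (3 / 4 * r)\<^sup>2"
      using that by (intro power_strict_mono) auto
    then have "A * (norm (y - c))\<^sup>2 < A * (3 / 4 * r)\<^sup>2"
      using A0 by (intro mult_strict_left_mono)
    also have "\<dots> = 144 * n"
      using Ar by (simp add: power_mult_distrib) (simp add: power2_eq_square)
    finally show ?thesis
      by (simp add: \<epsilon>_def \<epsilon>0_def)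
  qed
  have \<epsilon>1: "\<epsilon> y \<le> 1" "0 < \<epsilon> y" for y
    using A0 by (auto simp: \<epsilon>_def)
  define \<phi> where "\<phi> y = P y - Q * (\<epsilon> y - \<epsilon>0)" for y
  define g where "g y = a *\<^sub>R (y - x0) + (2 * A * Q * \<epsilon> y) *\<^sub>R (y - c)" for y
  define H where "H y w = (a + 2 * A * Q * \<epsilon> y) *\<^sub>R w
    - (4 * A\<^sup>2 * Q * \<epsilon> y * (w \<bullet> (y - c))) *\<^sub>R (y - c)" for y w
  have d\<epsilon>: "(\<epsilon> has_derivative (\<lambda>w. - (2 * A * \<epsilon> y * (w \<bullet> (y - c))))) (at y)" for y
  proof -
    define N where "N y = (norm (y - c))\<^sup>2" for y
    have dN: "(N has_derivative (\<lambda>w. 2 * (w \<bullet> (y - c)))) (at y)" for y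
      unfolding N_def by (rule has_derivative_power2_norm_diff)
    have "\<epsilon> = (\<lambda>y. exp (- (A * N y)))"
      by (simp add: fun_eq_iff \<epsilon>_def N_def)
    then show ?thesis
      by (auto intro!: derivative_eq_intros dN)
  qed
  have "GDERIV \<phi> y :> g y" for y
  proof -
    define N where "N y = (norm (y - x0))\<^sup>2" for y
    have dN: "(N has_derivative (\<lambda>w. 2 * (w \<bullet> (y - x0)))) (at y)" for y
      unfolding N_def by (rule has_derivative_power2_norm_diff)
    have wg: "w \<bullet> g y = a * (w \<bullet> (y - x0)) + 2 * A * Q * \<epsilon> y * (w \<bullet> (y - c))" for w
      unfolding g_def inner_add_right inner_scaleR_right ..
    have "\<phi> = (\<lambda>y. s0 + a / 2 * (N y - N z0) - Q * (\<epsilon> y - \<epsilon>0))"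
      by (simp add: fun_eq_iff \<phi>_def P_def N_def)
    then have "(\<phi> has_derivative (\<lambda>w. a / 2 * (2 * (w \<bullet> (y - x0))) - Q * (- (2 * A * \<epsilon> y * (w \<bullet> (y - c)))))) (at y)"
      by (auto intro!: derivative_eq_intros dN d\<epsilon>)
    then show ?thesis
      unfolding gderiv_def wg by (rule has_derivative_eq_rhs) (simp add: fun_eq_iff)
  qed
  moreover have "(g has_derivative H y) (at y)" for y
  proof -
    have "(g has_derivative (\<lambda>w. a *\<^sub>R w + ((2 * A * Q * \<epsilon> y) *\<^sub>R w
        + (2 * A * Q * - (2 * A * \<epsilon> y * (w \<bullet> (y - c)))) *\<^sub>R (y - c)))) (at y)"
      unfolding g_def by (auto intro!: derivative_eq_intros d\<epsilon>)
    then show ?thesis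
    proof (rule has_derivative_eq_rhs)
      have "2 * A * Q * - (2 * A * \<epsilon> y * t) = - (4 * A\<^sup>2 * Q * \<epsilon> y * t)" for t
        by (simp add: power2_eq_square)
      then show "(\<lambda>w. a *\<^sub>R w + ((2 * A * Q * \<epsilon> y) *\<^sub>R w
        + (2 * A * Q * - (2 * A * \<epsilon> y * (w \<bullet> (y - c)))) *\<^sub>R (y - c))) = H y"
        by (simp only: H_def fun_eq_iff scaleR_left_distrib scaleR_minus_left) simp
    qed
  qed
  moreover have "continuous_on UNIV (\<lambda>y. H y w)" for w
    unfolding H_def \<epsilon>_def by (intro continuous_intros)
  moreover have "H y u \<bullet> w = u \<bullet> H y w" for y u w
    unfolding H_def inner_diff_left[of "_ *\<^sub>R _" "_ *\<^sub>R _"] inner_diff_right[of _ "_ *\<^sub>R _" "_ *\<^sub>R _"] inner_scaleR_left inner_scaleR_right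
    by (simp add: inner_commute[of "y - c" w])
  ultimately have C2: "C2_with_derivatives \<phi> g H"
    by (simp add: C2_with_derivatives_def)
  define D where "D = cball c (3 / 4 * r)"
  define U where "U = ball c (3 / 4 * r) - cball c (r / 16)"
  have U: "open U" "U \<subseteq> D" "compact D"
    by (auto simp: U_def D_def)
  have D1: "norm y < 1" if "y \<in> D" for y
  proof -
    have "norm y \<le> norm c + norm (y - c)"
      using norm_triangle_ineq[of c "y - c"] by simp
    moreover have "norm (y - c) \<le> 3 / 4 * r"
      using that by (simp add: D_def dist_norm norm_minus_commute)
    ultimately show ?thesis
      using c(1,3) by linarith
  qed
  then have D: "D \<subseteq> ball 0 1"
    by auto
  have Ud: "r / 16 \<le> norm (y - c)" "norm (y - c) < 3 / 4 * r" if "y \<in> U" for y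
    using that by (auto simp: U_def dist_norm norm_minus_commute)
  define L where "L = 4 * (256 * n)\<^sup>2 * q * a"
  define M where "M = 2 + 256 * n * q"
  have gb: "norm (g y) \<le> M * a" if y: "y \<in> U" for y
  proof -
    have "norm (y - x0) \<le> 2"
      using norm_triangle_ineq4[of y x0] D1[of y] U(2) y c0(2) by force
    then have "a * norm (y - x0) \<le> a * 2"
      using a by (intro mult_left_mono) auto
    moreover have "(2 * A * Q * \<epsilon> y) * norm (y - c) \<le> (2 * A * Q * 1) * (1 / 2)"
      using Ud[OF y] c A0 Q0 \<epsilon>1[of y] by (intro mult_mono) auto
    moreover have "norm (g y) \<le> a * norm (y - x0) + (2 * A * Q * \<epsilon> y) * norm (y - c)"
      unfolding g_def using a A0 Q0 \<epsilon>1[of y] by (intro norm_triangle_le) simp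
    ultimately show ?thesis
      using AQ by (simp add: M_def algebra_simps)
  qed
  have A2: "4 * A\<^sup>2 * Q * \<epsilon> y * (norm (y - c))\<^sup>2 \<le> L" if "y \<in> U" for y
  proof -
    have "(norm (y - c))\<^sup>2 \<le> r\<^sup>2"
      using Ud[OF that] c(2) by (intro power_mono) auto
    then have "4 * A\<^sup>2 * Q * \<epsilon> y * (norm (y - c))\<^sup>2 \<le> 4 * A\<^sup>2 * Q * 1 * r\<^sup>2"
      using A0 Q0 \<epsilon>1[of y] by (intro mult_mono) auto
    also have "\<dots> = 4 * (A * r\<^sup>2) * (A * Q)"
      by (simp add: power2_eq_square)
    also have "\<dots> = L"
      unfolding Ar AQ by (simp add: L_def power2_eq_square)
    finally show ?thesis .
  qed
  have low: "- L * (norm w)\<^sup>2 \<le> H y w \<bullet> w" if "y \<in> U" for y w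
  proof -
    have "H y w \<bullet> w = (a + 2 * A * Q * \<epsilon> y) * (norm w)\<^sup>2 - 4 * A\<^sup>2 * Q * \<epsilon> y * ((y - c) \<bullet> w)\<^sup>2"
      unfolding H_def inner_diff_left[of "_ *\<^sub>R _" "_ *\<^sub>R _"] inner_scaleR_left power2_norm_eq_inner
      by (simp add: inner_commute[of w "y - c"] power2_eq_square[of "(y - c) \<bullet> w"])
    moreover have "0 \<le> (a + 2 * A * Q * \<epsilon> y) * (norm w)\<^sup>2"
      using a A0 Q0 \<epsilon>1[of y] by simp
    moreover have "4 * A\<^sup>2 * Q * \<epsilon> y * ((y - c) \<bullet> w)\<^sup>2 \<le> 4 * A\<^sup>2 * Q * \<epsilon> y * ((norm (y - c))\<^sup>2 * (norm w)\<^sup>2)"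
      using power2_inner_le[of "y - c" w] A0 Q0 \<epsilon>1[of y] by (intro mult_left_mono) auto
    moreover have "(4 * A\<^sup>2 * Q * \<epsilon> y * (norm (y - c))\<^sup>2) * (norm w)\<^sup>2 \<le> L * (norm w)\<^sup>2"
      using A2[OF that] by (intro mult_right_mono) auto
    ultimately show ?thesis
      by (simp add: mult.assoc)
  qed
  have tr: "(\<Sum>i\<in>Basis. H y i \<bullet> i) \<le> - (511 * a)" if "y \<in> U" for y
  proof -
    have "(\<Sum>i\<in>Basis. H y i \<bullet> i)
        = (\<Sum>i\<in>Basis. (a + 2 * A * Q * \<epsilon> y) - 4 * A\<^sup>2 * Q * \<epsilon> y * ((y - c) \<bullet> i)\<^sup>2)"
      unfolding H_def inner_diff_left[of "_ *\<^sub>R _" "_ *\<^sub>R _"] inner_scaleR_left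
      by (intro sum.cong refl) (simp add: inner_commute[of _ "y - c"] power2_eq_square[of "(y - c) \<bullet> _"])
    also have "\<dots> = n * (a + 2 * A * Q * \<epsilon> y) - 4 * A\<^sup>2 * Q * \<epsilon> y * (norm (y - c))\<^sup>2"
      by (simp add: sum_subtractf sum_distrib_left[symmetric] sum_Basis_power2_inner n_def)
    also have "\<dots> \<le> n * (a + 2 * A * Q * \<epsilon> y) - 4 * A\<^sup>2 * Q * \<epsilon> y * (r / 16)\<^sup>2"
      using Ud[OF that] A0 Q0 \<epsilon>1[of y] c(2) by (intro diff_left_mono mult_left_mono power_mono) auto
    also have "4 * A\<^sup>2 * Q * \<epsilon> y * (r / 16)\<^sup>2 = 4 * (A * r\<^sup>2) * (A * Q) * \<epsilon> y / 256"
      by (simp add: power2_eq_square)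
    also have "n * (a + 2 * A * Q * \<epsilon> y) - \<dots> = n * a - 2 * n * (A * Q) * \<epsilon> y"
      unfolding Ar by (simp add: algebra_simps)
    also have "\<dots> = n * a - 512 * n * n * a * (q * \<epsilon> y)"
      unfolding AQ by (simp add: algebra_simps)
    also have "\<dots> \<le> n * a - 512 * n * n * a * 1"
    proof (intro diff_left_mono mult_left_mono)
      have "1 = q * \<epsilon>0"
        by (simp add: q_def barrier_depth_def \<epsilon>0_def flip: exp_add)
      also have "\<dots> \<le> q * \<epsilon> y"
        using \<epsilon>0[of y] Ud[OF that] q1 by (intro mult_left_mono) auto
      finally show "1 \<le> q * \<epsilon> y" .
    qed (use n1 a in auto)
    also have "\<dots> \<le> - (511 * a)"
    proof -
      have "n * a \<le> n * (n * a)"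
        using n1 a by simp
      moreover have "a \<le> n * a"
        using n1 a by simp
      ultimately have "n * a - 512 * (n * (n * a)) \<le> - (511 * a)"
        by linarith
      then show ?thesis
        by (simp add: mult.assoc)
    qed
    finally show ?thesis .
  qed
  have super: "(\<Sum>i\<in>Basis. H y i \<bullet> i) + 2 * L * (norm (g y))\<^sup>2 + h * sqrt (1 + (norm (g y))\<^sup>2) < 0"
    if "y \<in> U" for y
  proof -
    let ?B = "barrier_size n"
    have B: "?B = 8 * (256 * n)\<^sup>2 * q * M\<^sup>2"
      by (simp add: barrier_size_def M_def q_def)
    have "1 \<le> n\<^sup>2 * q * 524288"
      using n1 q1 by (intro order_trans[OF _ mult_mono[of 1 "n\<^sup>2 * q" 1 524288]] order_trans[OF _ mult_mono[of 1 "n\<^sup>2" 1 q]])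
        (auto simp: one_le_power)
    then have MB: "M\<^sup>2 \<le> ?B"
      unfolding B using mult_right_mono[of 1 "n\<^sup>2 * q * 524288" "M\<^sup>2"] by (simp add: power_mult_distrib mult.commute)
    have "4 \<le> M\<^sup>2"
      using power_mono[of 2 M 2] n1 q1 by (simp add: M_def)
    then have B1: "1 \<le> ?B"
      using MB by linarith
    then have a1: "a \<le> 1"
      using a(1,2) mult_left_mono[of 1 ?B a] by linarith
    have "(norm (g y))\<^sup>2 \<le> (M * a)\<^sup>2"
      using gb[OF that] by (intro power_mono) auto
    then have g2: "(norm (g y))\<^sup>2 \<le> M\<^sup>2 * a\<^sup>2"
      by (simp add: power_mult_distrib)
    have Ba: "?B * a\<^sup>2 \<le> a"
      using mult_right_mono[OF a(2), of a] a(1) by (simp add: power2_eq_square algebra_simps)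
    have "M\<^sup>2 * a\<^sup>2 \<le> ?B * a\<^sup>2"
      using MB by (intro mult_right_mono) auto
    then have g1: "(norm (g y))\<^sup>2 \<le> 1"
      using g2 Ba a1 by linarith
    have "h * sqrt (1 + (norm (g y))\<^sup>2) \<le> a * 2"
      using g1 h0 a by (intro mult_mono sqrt_one_plus_le_two) auto
    moreover have "2 * L * (norm (g y))\<^sup>2 \<le> 2 * L * (M\<^sup>2 * a\<^sup>2)"
      using g2 q1 a by (intro mult_left_mono) (auto simp: L_def)
    moreover have "2 * L * (M\<^sup>2 * a\<^sup>2) = a * (?B * a\<^sup>2)"
      by (simp add: L_def B)
    moreover have "a * (?B * a\<^sup>2) \<le> a * 1"
      using Ba a1 a(1) by (intro mult_left_mono) auto
    ultimately show ?thesis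
      using tr[OF that] a(1) by linarith
  qed
  have bdry: "s \<le> \<phi> y" if "(y, s) \<in> \<Gamma>" "y \<in> D" "y \<notin> U" for y s
  proof -
    have "norm (y - c) \<le> 3 / 4 * r" "\<not> (norm (y - c) < 3 / 4 * r \<and> r / 16 < norm (y - c))"
      using that(2,3) by (auto simp: U_def D_def dist_norm norm_minus_commute)
    then consider "norm (y - c) \<le> r / 16" | "norm (y - c) = 3 / 4 * r"
      by linarith
    then show ?thesis
    proof cases
      case 1
      have "Q * (\<epsilon> y - \<epsilon>0) \<le> Q * 1"
        using Q0 \<epsilon>1[of y] by (intro mult_left_mono) (simp_all add: \<epsilon>0_def diff_le_eq add_increasing2)
      then show ?thesis
        using low_near[OF that(1) 1] by (simp add: \<phi>_def Q_def)
    next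
      case 2
      have "\<epsilon> y = \<epsilon>0"
        using Ar by (simp add: \<epsilon>_def \<epsilon>0_def 2 power_mult_distrib) (simp add: power2_eq_square)
      then show ?thesis
        using contact_above[OF c0(1) that(1)] by (simp add: \<phi>_def P_def)
    qed
  qed
  have z0: "z0 \<in> D" "norm (z0 - c) < 3 / 4 * r"
    using c by (auto simp: D_def dist_norm norm_minus_commute)
  then have "(z0, s0) \<in> \<Gamma>"
    using contact_mem[OF nh c0(1)] D1 by simp
  moreover have "0 < L"
    using n1 q1 a by (simp add: L_def)
  ultimately have "s0 \<le> \<phi> z0"
    using nh_comparison[OF nh neg C2 U D _ low super bdry] z0(1) by blast
  moreover have "\<phi> z0 = s0 - Q * (\<epsilon> z0 - \<epsilon>0)"
    by (simp add: \<phi>_def P_def)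
  moreover have "0 < Q * (\<epsilon> z0 - \<epsilon>0)"
    using Q0 \<epsilon>0[OF z0(2)] by simp
  ultimately show False
    by linarith
qed

section \<open>Measure of the touching set near a contact\<close>

text \<open>
Both Vitali arguments below end with this count: the large sets \<open>F i\<close> cover, and the disjoint sets
\<open>E i\<close>, of proportional measure, fit into \<open>W\<close>.
\<close>

lemma measure_UN_le_disjoint_subsets:
  fixes E F :: "'i \<Rightarrow> 'a::euclidean_space set"
  assumes C: "countable C" and F: "\<And>i. i \<in> C \<Longrightarrow> F i \<in> lmeasurable"
    and E: "\<And>i. i \<in> C \<Longrightarrow> E i \<in> lmeasurable" "pairwise (\<lambda>i j. disjnt (E i) (E j)) C"
    and W: "\<And>i. i \<in> C \<Longrightarrow> E i \<subseteq> W" "W \<in> lmeasurable"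
    and le: "\<And>i. i \<in> C \<Longrightarrow> measure lebesgue (F i) \<le> c * measure lebesgue (E i)" and c: "0 \<le> c"
  shows "(\<Union>i\<in>C. F i) \<in> lmeasurable" "measure lebesgue (\<Union>i\<in>C. F i) \<le> c * measure lebesgue W"
proof -
  have bound: "measure lebesgue (\<Union>i\<in>I. F i) \<le> c * measure lebesgue W" if I: "I \<subseteq> C" "finite I" for I
  proof -
    have "measure lebesgue (\<Union>i\<in>I. F i) \<le> (\<Sum>i\<in>I. measure lebesgue (F i))"
      using I F by (intro measure_UNION_le) (auto dest: fmeasurableD)
    also have "\<dots> \<le> (\<Sum>i\<in>I. c * measure lebesgue (E i))"
      using I le by (intro sum_mono) auto
    also have "\<dots> = c * measure lebesgue (\<Union>i\<in>I. E i)"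
      using I E by (subst measure_UNION') (auto simp: sum_distrib_left intro: pairwise_subset)
    also have "\<dots> \<le> c * measure lebesgue W"
      using I E W c by (intro mult_left_mono measure_mono_fmeasurable) (auto intro!: sets.finite_UN dest: fmeasurableD)
    finally show ?thesis .
  qed
  show "(\<Union>i\<in>C. F i) \<in> lmeasurable" "measure lebesgue (\<Union>i\<in>C. F i) \<le> c * measure lebesgue W"
    using fmeasurable_UN_bound[OF C F bound] measure_UN_bound[OF C F bound] by auto
qed

lemma measure_ball_scale:
  fixes x y :: "'a::euclidean_space"
  assumes "0 \<le> r" "0 \<le> k"
  shows "measure lebesgue (ball x (k * r)) = k ^ DIM('a) * measure lebesgue (ball y r)"
  using assms by (simp add: content_ball power_mult_distrib)

text \<open>
A Lipschitz image of \<open>S\<close> has measure at most a constant times that of \<open>S\<close>; the covering argument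
gives a constant that is not sharp and needs no differentiability.  A relation in place of a map
avoids choosing a center for every touching point.
\<close>

lemma measure_le_of_Lipschitz_correspondence:
  fixes B S :: "'a::euclidean_space set"
  assumes S: "compact S" and B: "B \<in> lmeasurable" and cover: "\<And>x. x \<in> B \<Longrightarrow> \<exists>z\<in>S. R x z"
    and Lip: "\<And>x z x' z'. R x z \<Longrightarrow> R x' z' \<Longrightarrow> z \<in> S \<Longrightarrow> z' \<in> S \<Longrightarrow> norm (x - x') \<le> K * norm (z - z')"
    and K: "0 < K"
  shows "measure lebesgue B \<le> (5 * K) ^ DIM('a) * measure lebesgue S"
proof (rule field_le_epsilon)
  fix \<epsilon> :: real assume \<epsilon>: "0 < \<epsilon>"
  define k where "k = (5 * K) ^ DIM('a)"
  have k: "0 < k"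
    using K by (simp add: k_def)
  have Sm: "S \<in> lmeasurable"
    using S by (rule lmeasurable_compact)
  obtain U where U: "open U" "S \<subseteq> U" "U - S \<in> lmeasurable" "emeasure lebesgue (U - S) < ennreal (\<epsilon> / k)"
    using sets_lebesgue_outer_open[of S "\<epsilon> / k"] Sm \<epsilon> k by (metis divide_pos_pos fmeasurableD)
  have "U = S \<union> (U - S)"
    using U(2) by auto
  then have Um: "U \<in> lmeasurable" and Ule: "measure lebesgue U \<le> measure lebesgue S + measure lebesgue (U - S)"
    using Sm U(3) by (metis fmeasurable.Un, metis measure_Un_le fmeasurableD)
  have "measure lebesgue (U - S) < \<epsilon> / k"
    using U(3,4) \<epsilon> k by (simp add: emeasure_eq_measure2 ennreal_less_iff)
  with Ule have Ule: "measure lebesgue U \<le> measure lebesgue S + \<epsilon> / k"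
    by linarith
  have "\<exists>r. 0 < r \<and> r \<le> 1 \<and> ball z r \<subseteq> U" if z: "z \<in> S" for z
  proof -
    obtain r where "0 < r" "ball z r \<subseteq> U"
      using U(1,2) z open_contains_ball by blast
    then show ?thesis
      by (intro exI[of _ "min r 1"]) auto
  qed
  then obtain r where r: "\<And>z. z \<in> S \<Longrightarrow> 0 < r z \<and> r z \<le> 1 \<and> ball z (r z) \<subseteq> U"
    by metis
  define I where "I = {p. R (fst p) (snd p) \<and> snd p \<in> S}"
  have r': "0 < r (snd p) \<and> r (snd p) \<le> 1" if "p \<in> I" for p
    using r that by (auto simp: I_def)
  obtain C where C: "countable C" "C \<subseteq> I"
    "pairwise (\<lambda>p q. disjnt (ball (snd p) (r (snd p))) (ball (snd q) (r (snd q)))) C"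
    "snd ` I \<subseteq> (\<Union>p\<in>C. ball (snd p) (5 * r (snd p)))"
    using Vitali_covering_lemma_balls[where S = "snd ` I" and K = I and a = snd and r = "\<lambda>p. r (snd p)" and B = 1] r' by force
  let ?F = "\<lambda>p. ball (fst p) ((5 * K) * r (snd p))"
  have BF: "B \<subseteq> (\<Union>p\<in>C. ?F p)"
  proof
    fix x assume "x \<in> B"
    then obtain z where z: "z \<in> S" "R x z"
      using cover by blast
    then have "z \<in> snd ` I"
      by (intro image_eqI[of _ _ "(x, z)"]) (auto simp: I_def)
    then obtain p where p: "p \<in> C" "norm (snd p - z) < 5 * r (snd p)"
      using C(4) by (auto simp: dist_norm)
    have "norm (fst p - x) \<le> K * norm (snd p - z)"
      using p(1) C(2) z by (intro Lip) (auto simp: I_def)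
    also have "\<dots> < K * (5 * r (snd p))"
      using p K by simp
    finally have "x \<in> ?F p"
      by (simp add: dist_norm mult_ac)
    then show "x \<in> (\<Union>p\<in>C. ?F p)"
      using p(1) by blast
  qed
  have FE: "measure lebesgue (?F p) \<le> k * measure lebesgue (ball (snd p) (r (snd p)))" if "p \<in> C" for p
    unfolding k_def using r'[of p] C(2) that K by (subst measure_ball_scale[of _ _ _ "snd p"]) auto
  have "ball (snd p) (r (snd p)) \<subseteq> U" if "p \<in> C" for p
    using r C(2) that by (auto simp: I_def)
  note F = measure_UN_le_disjoint_subsets[OF C(1) _ _ C(3) this Um FE]
  have "measure lebesgue B \<le> measure lebesgue (\<Union>p\<in>C. ?F p)"
    using BF B F(1) k by (intro measure_mono_fmeasurable) (auto dest: fmeasurableD)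
  also have "\<dots> \<le> k * measure lebesgue U"
    using F(2) k by auto
  also have "\<dots> \<le> k * (measure lebesgue S + \<epsilon> / k)"
    using Ule k by (intro mult_left_mono) auto
  also have "\<dots> = k * measure lebesgue S + \<epsilon>"
    using k by (simp add: distrib_left)
  finally show "measure lebesgue B \<le> (5 * K) ^ DIM('a) * measure lebesgue S + \<epsilon>"
    by (simp add: k_def)
qed

lemma nh_subset_cylinder: "nh_subset h \<Omega> \<Gamma> \<Longrightarrow> \<Gamma> \<subseteq> \<Omega>"
  using closedin_subset by (fastforce simp: nh_subset_def)

text \<open>
The scale \<open>d\<close> of the local estimate may be any positive bound for \<open>|z1 - z0|\<close>, so coinciding contact
points are covered by letting it tend to zero; large distances are trivial because the centers
lie in the unit ball.
\<close>

lemma contact_centers_Lipschitz: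
  fixes \<Gamma> :: "((real ^ 'n) \<times> real) set"
  assumes nh: "nh_subset h (cylinder 1) \<Gamma>" and neg: "\<Gamma> \<subseteq> {x. snd x \<le> 0}"
    and c0: "contact b \<Gamma> x0 z0 s0" "norm x0 \<le> 1" "norm z0 \<le> 1 / 3"
    and c1: "contact b \<Gamma> x1 z1 s1" "norm x1 \<le> 1"
    and b: "0 < b" "b \<le> 1 / 20" "h \<le> b"
  shows "norm (x1 - x0) \<le> 36 * real CARD('n) * norm (z1 - z0)"
proof -
  define n where "n = real CARD('n)"
  have n1: "1 \<le> n"
    unfolding n_def using zero_less_card_finite[where 'a = 'n] by linarith
  note at_scale = contact_centers_close_at_scale[OF nh neg c0 c1(1) b, folded n_def]
  show ?thesis
    unfolding n_def[symmetric]
  proof (cases "14 * n * norm (z1 - z0) < 1")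
    case True
    show "norm (x1 - x0) \<le> 36 * n * norm (z1 - z0)"
    proof (rule dense_ge)
      fix t assume t: "36 * n * norm (z1 - z0) < t"
      define d where "d = min (t / (36 * n)) (1 / (14 * n))"
      have "norm (x1 - x0) \<le> 36 * n * d"
      proof (rule at_scale)
        have "0 \<le> 36 * n * norm (z1 - z0)"
          using n1 by simp
        then have "0 < t"
          using t by linarith
        then show "0 < d"
          using n1 by (simp add: d_def)
        have "d \<le> 1 / (14 * n)"
          by (simp add: d_def)
        then show "14 * n * d \<le> 1"
          using n1 by (simp add: field_simps)
        show "norm (z1 - z0) \<le> d"
          using t True n1 by (simp add: d_def field_simps)
      qed
      also have "\<dots> \<le> 36 * n * (t / (36 * n))"
        using n1 by (intro mult_left_mono) (auto simp: d_def)
      finally show "norm (x1 - x0) \<le> t"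
        using n1 by simp
    qed
  next
    case False
    then show "norm (x1 - x0) \<le> 36 * n * norm (z1 - z0)"
      using norm_triangle_ineq4[of x1 x0] c0(2) c1(2) by linarith
  qed
qed

text \<open>
Near a contact of opening \<open>a\<close>, the paraboloids of opening \<open>(N + 1) a\<close> touch in a set of positive
density.  Let \<open>(y1, s1)\<close> be a point of \<open>\<Gamma>\<close> close to the touching paraboloid \<open>P\<close> and to \<open>c\<close>.  For \<open>\<xi>\<close>
near \<open>c\<close> the paraboloid \<open>P + (N a / 2) |y - \<xi>|\<^sup>2 + const\<close> that touches \<open>\<Gamma>\<close> cannot do so far from
\<open>c\<close>, since there it would be above \<open>P\<close> if it is above \<open>(y1, s1)\<close>.  The centers so obtained fill a
ball of radius \<open>r / 256\<close>, and they are a Lipschitz function of the contact points; the constant is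
\<open>230400 = (5 * 36) * (5 * 256)\<close>.
\<close>

lemma measure_touching_set_near_contact:
  fixes \<Gamma> :: "((real ^ 'n) \<times> real) set" and y0 :: "real ^ 'n"
  defines "n \<equiv> real CARD('n)"
  assumes nh: "nh_subset h (cylinder 1) \<Gamma>" and neg: "\<Gamma> \<subseteq> {x. snd x \<le> 0}"
    and c0: "contact a \<Gamma> x0 z0 s0" "norm x0 \<le> 1"
    and a: "0 < a" "a * barrier_size n \<le> 1" "h \<le> a"
    and N: "8192 * barrier_depth n \<le> N" "(N + 1) * a \<le> 1 / 20"
    and c: "norm c \<le> 1 / 3" "0 < r" "r \<le> 2 / 3" "norm (z0 - c) \<le> 5 / 8 * r"
      "cball c (r / 8) \<subseteq> cball 0 (1 / 3)"
  shows "measure lebesgue (ball y0 (5 * r))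
    \<le> (230400 * n) ^ CARD('n) * measure lebesgue (touching_set ((N + 1) * a) \<Gamma> \<inter> cball c (r / 8))"
proof -
  define q where "q = barrier_depth n"
  define b where "b = (N + 1) * a"
  have n1: "1 \<le> n"
    unfolding n_def using zero_less_card_finite[where 'a = 'n] by linarith
  have q1: "1 \<le> q"
    using n1 by (simp add: q_def barrier_depth_def)
  have N1: "1 \<le> N"
    using N q1 by (simp add: q_def)
  have cyl: "\<Gamma> \<subseteq> cylinder 1"
    using nh by (rule nh_subset_cylinder)
  obtain y1 s1 where 1: "(y1, s1) \<in> \<Gamma>" "norm (y1 - c) \<le> r / 16"
    "s0 + a / 2 * ((norm (y1 - x0))\<^sup>2 - (norm (z0 - x0))\<^sup>2) - q * a * r\<^sup>2 \<le> s1"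
    using nearby_point_of_contact[OF nh neg c0 a[unfolded n_def] c(1-4)] unfolding q_def n_def by metis
  define S where "S = touching_set b \<Gamma> \<inter> cball c (r / 8)"
  define R where "R w z \<longleftrightarrow> norm w \<le> 1 \<and> (\<exists>s. contact b \<Gamma> w z s)" for w z
  \<comment> \<open>By \<open>paraboloid_sum\<close>, the center for \<open>\<xi> = c\<close>.\<close>
  define w0 where "w0 = (1 / (N + 1)) *\<^sub>R (x0 + N *\<^sub>R c)"
  have aN: "a + N * a = b"
    by (simp add: b_def algebra_simps)
  have b: "0 < b" "b \<le> 1 / 20" "h \<le> b"
  proof -
    show "0 < b" "b \<le> 1 / 20"
      using a N N1 by (auto simp: b_def)
    have "0 \<le> N * a"
      using a N1 by simp
    then show "h \<le> b"
      using a aN by linarith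
  qed
  have cover: "\<exists>z\<in>S. R w z" if w: "w \<in> cball w0 (r / 256)" for w
  proof -
    define \<xi> where "\<xi> = (1 / N) *\<^sub>R ((N + 1) *\<^sub>R w - x0)"
    have sum: "(N + 1) *\<^sub>R w = x0 + N *\<^sub>R \<xi>"
      using N1 by (simp add: \<xi>_def)
    have "(N + 1) *\<^sub>R w0 = x0 + N *\<^sub>R c"
      using N1 by (simp add: w0_def)
    then have "N *\<^sub>R (\<xi> - c) = (N + 1) *\<^sub>R (w - w0)"
      using sum by (simp add: scaleR_diff_right)
    then have "N * norm (\<xi> - c) = (N + 1) * norm (w - w0)"
      using N1 by (metis abs_of_nonneg add_nonneg_nonneg norm_scaleR order_trans zero_le_one)
    also have "\<dots> \<le> (N + N) * (r / 256)"
      using w N1 by (intro mult_mono) (auto simp: dist_norm norm_minus_commute)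
    finally have "N * norm (\<xi> - c) \<le> N * (r / 128)"
      by simp
    then have \<xi>: "norm (\<xi> - c) \<le> r / 128"
      using N1 by simp
    have "norm \<xi> \<le> norm c + norm (\<xi> - c)"
      using norm_triangle_ineq[of c "\<xi> - c"] by simp
    then have \<xi>1: "norm \<xi> \<le> 1"
      using \<xi> c by linarith
    have "(N + 1) * norm w = norm (x0 + N *\<^sub>R \<xi>)"
      using sum N1 by (metis abs_of_nonneg add_nonneg_nonneg norm_scaleR order_trans zero_le_one)
    also have "\<dots> \<le> norm x0 + N * norm \<xi>"
      using N1 by (intro norm_triangle_le) simp
    also have "\<dots> \<le> 1 + N * 1"
      using N1 \<xi>1 c0(2) by (intro add_mono mult_left_mono) auto
    finally have "(N + 1) * norm w \<le> (N + 1) * 1"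
      by simp
    then have w1: "norm w \<le> 1"
      using N1 by (simp only: mult_le_cancel_left_pos)
    obtain z s where z: "contact b \<Gamma> w z s"
      using contact_exists[OF cyl neg, of b w] 1(1) by blast
    have "(a + N * a) *\<^sub>R w = a *\<^sub>R ((N + 1) *\<^sub>R w)"
      by (simp add: algebra_simps)
    then have "(a + N * a) *\<^sub>R w = a *\<^sub>R x0 + (N * a) *\<^sub>R \<xi>"
      unfolding sum by (simp add: scaleR_add_right mult.commute)
    note sq = paraboloid_sum[OF this, of y1 z, unfolded aN]
    have "s1 \<le> s + b / 2 * ((norm (y1 - w))\<^sup>2 - (norm (z - w))\<^sup>2)"
      by (rule contact_above[OF z 1(1)])
    moreover have "s \<le> s0 + a / 2 * ((norm (z - x0))\<^sup>2 - (norm (z0 - x0))\<^sup>2)"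
      using c0(1) z by (simp add: contact_def)
    ultimately have "0 \<le> N * a * ((norm (y1 - \<xi>))\<^sup>2 - (norm (z - \<xi>))\<^sup>2) + 2 * (q * a * r\<^sup>2)"
      using 1(3) sq by (simp add: right_diff_distrib)
    also have "\<dots> = a * (N * ((norm (y1 - \<xi>))\<^sup>2 - (norm (z - \<xi>))\<^sup>2) + 2 * q * r\<^sup>2)"
      by (simp add: algebra_simps)
    finally have "0 \<le> N * ((norm (y1 - \<xi>))\<^sup>2 - (norm (z - \<xi>))\<^sup>2) + 2 * q * r\<^sup>2"
      using a(1) by (simp add: zero_le_mult_iff)
    also have "2 * q * r\<^sup>2 \<le> N * (r\<^sup>2 / 4096)"
      using N(1) mult_right_mono[of "8192 * q" N "r\<^sup>2 / 4096"] by (simp add: q_def)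
    finally have "0 \<le> N * ((norm (y1 - \<xi>))\<^sup>2 - (norm (z - \<xi>))\<^sup>2 + r\<^sup>2 / 4096)"
      by (simp add: distrib_left)
    then have "(norm (z - \<xi>))\<^sup>2 \<le> (norm (y1 - \<xi>))\<^sup>2 + r\<^sup>2 / 4096"
      using N1 by (simp add: zero_le_mult_iff)
    also have "norm (y1 - \<xi>) \<le> r / 16 + r / 128"
      using norm_triangle_ineq4[of "y1 - c" "\<xi> - c"] 1(2) \<xi> by simp
    then have "(norm (y1 - \<xi>))\<^sup>2 \<le> (r / 16 + r / 128)\<^sup>2"
      by (intro power_mono) auto
    also have "(r / 16 + r / 128)\<^sup>2 + r\<^sup>2 / 4096 \<le> (15 / 128 * r)\<^sup>2"
      by (simp add: power2_eq_square)
    finally have "(norm (z - \<xi>))\<^sup>2 \<le> (15 / 128 * r)\<^sup>2"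
      by simp
    moreover have "0 \<le> 15 / 128 * r"
      using c(2) by linarith
    ultimately have "norm (z - \<xi>) \<le> 15 / 128 * r"
      by (rule power2_le_imp_le)
    then have "norm (z - c) \<le> r / 8"
      using norm_triangle_ineq[of "z - \<xi>" "\<xi> - c"] \<xi> by simp
    then have "z \<in> S"
      using z w1 by (auto simp: S_def touching_set_eq dist_norm norm_minus_commute)
    then show ?thesis
      using z w1 by (auto simp: R_def)
  qed
  have "compact S"
    unfolding S_def using compact_touching_set[OF cyl neg, of b] b by (intro compact_Int) auto
  moreover have "norm (w - w') \<le> 36 * n * norm (z - z')"
    if "R w z" "R w' z'" "z \<in> S" "z' \<in> S" for w z w' z'
    using that c(5) contact_centers_Lipschitz[OF nh neg _ _ _ _ _ b, of w' z' _ w z]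
    unfolding R_def n_def S_def by (meson IntD2 mem_cball_0 subsetD)
  ultimately have "measure lebesgue (cball w0 (r / 256)) \<le> (5 * (36 * n)) ^ DIM(real ^ 'n) * measure lebesgue S"
    using cover n1 by (intro measure_le_of_Lipschitz_correspondence[where R = R]) auto
  moreover have "measure lebesgue (ball w0 (r / 256)) \<le> measure lebesgue (cball w0 (r / 256))"
    by (intro measure_mono_fmeasurable) auto
  ultimately have le: "measure lebesgue (ball w0 (r / 256)) \<le> (180 * n) ^ CARD('n) * measure lebesgue S"
    by simp
  have "measure lebesgue (ball y0 (5 * r)) = 1280 ^ CARD('n) * measure lebesgue (ball w0 (r / 256))"
    using measure_ball_scale[of "r / 256" 1280 y0 w0] c(2) by simp
  also have "\<dots> \<le> 1280 ^ CARD('n) * ((180 * n) ^ CARD('n) * measure lebesgue S)"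
    using le by (intro mult_left_mono) auto
  also have "\<dots> = (230400 * n) ^ CARD('n) * measure lebesgue S"
    by (simp add: power_mult_distrib flip: mult.assoc) (simp flip: power_mult_distrib)
  finally show ?thesis
    by (simp add: S_def b_def)
qed

section \<open>Decay of the untouched set\<close>

text \<open>
Every point \<open>y\<close> that is not yet touched has, in the ball that reaches to the nearest touched point
\<open>z\<close>, a proportional amount of points touched by the larger opening.  A Vitali covering by these balls
shows that a fixed fraction of the untouched set is gained.
\<close>

lemma measure_untouched_decay:
  fixes \<Gamma> :: "((real ^ 'n) \<times> real) set"
  defines "n \<equiv> real CARD('n)"
  assumes nh: "nh_subset h (cylinder 1) \<Gamma>" and neg: "\<Gamma> \<subseteq> {x. snd x \<le> 0}"
    and a: "0 < a" "a * barrier_size n \<le> 1" "h \<le> a"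
    and N: "8192 * barrier_depth n \<le> N" "(N + 1) * a \<le> 1 / 20"
    and ne: "touching_set a \<Gamma> \<inter> cball 0 (1 / 3) \<noteq> {}"
  shows "measure lebesgue (cball 0 (1 / 3) - touching_set ((N + 1) * a) \<Gamma>)
    \<le> (1 - 1 / (230400 * n) ^ CARD('n)) * measure lebesgue (cball 0 (1 / 3) - touching_set a \<Gamma>)"
proof -
  define B where "B = cball (0 :: real ^ 'n) (1 / 3)"
  define \<kappa> where "\<kappa> = (230400 * n) ^ CARD('n)"
  define b where "b = (N + 1) * a"
  define Da where "Da = touching_set a \<Gamma> \<inter> B"
  define Db where "Db = touching_set b \<Gamma> \<inter> B"
  have n1: "1 \<le> n"
    unfolding n_def using zero_less_card_finite[where 'a = 'n] by linarith
  have \<kappa>: "0 < \<kappa>"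
    using n1 by (simp add: \<kappa>_def)
  have cyl: "\<Gamma> \<subseteq> cylinder 1"
    using nh by (rule nh_subset_cylinder)
  have "0 < barrier_depth n"
    by (simp add: barrier_depth_def)
  then have "0 \<le> N * a"
    using N(1) a(1) by simp
  then have ab: "a \<le> b" "0 < b"
    using a(1) by (simp_all add: b_def distrib_right)
  have sub: "Da \<subseteq> Db"
    using touching_set_mono[OF cyl neg a(1) ab(1)] by (auto simp: Da_def Db_def)
  have cpt: "compact Da" "compact Db"
    using compact_touching_set[OF cyl neg] a(1) ab(2)
    by (auto simp: Da_def Db_def B_def intro!: compact_Int)
  have meas: "Da \<in> lmeasurable" "Db \<in> lmeasurable" "B \<in> lmeasurable"
    using cpt by (auto simp: lmeasurable_compact B_def)
  have near: "\<exists>c r. 0 < r \<and> r \<le> 2 / 3 \<and> cball c (r / 8) \<subseteq> ball y r \<inter> B - Da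
      \<and> measure lebesgue (ball y (5 * r)) \<le> \<kappa> * measure lebesgue (touching_set b \<Gamma> \<inter> cball c (r / 8))"
    if y: "y \<in> B - Da" for y
  proof -
    define r where "r = infdist y Da"
    have "Da \<noteq> {}"
      using ne by (simp add: Da_def B_def)
    obtain z where z: "z \<in> Da" "r = dist y z"
      using infdist_attains_inf[OF compact_imp_closed[OF cpt(1)] \<open>Da \<noteq> {}\<close>, of y] by (auto simp: r_def)
    have "ball y r \<inter> Da = {}"
      using infdist_le[of _ Da y] by (fastforce simp: r_def)
    have r0: "0 < r"
      using y z by auto
    have yz: "norm y \<le> 1 / 3" "norm z \<le> 1 / 3"
      using y z(1) by (auto simp: Da_def B_def)
    have rn: "norm (y - z) = r"
      using z(2) by (simp add: dist_norm)
    have r1: "r \<le> 2 / 3"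
      using norm_triangle_ineq4[of y z] yz rn by linarith
    \<comment> \<open>The midpoint of \<open>y\<close> and \<open>z\<close>, moved towards the origin to leave room for a ball of radius
      \<open>r / 8\<close> inside \<open>B\<close>; the shift is short enough to stay close to both \<open>y\<close> and \<open>z\<close>.\<close>
    define m where "m = (1 / 2) *\<^sub>R (y + z)"
    define c where "c = (1 - 3 / 8 * r) *\<^sub>R m"
    have m: "norm m \<le> 1 / 3"
      using norm_triangle_ineq[of y z] yz by (simp add: m_def)
    have cm: "norm (c - m) \<le> r / 8"
    proof -
      have "c - m = - ((3 / 8 * r) *\<^sub>R m)"
        by (simp add: c_def algebra_simps)
      then have "norm (c - m) = (3 / 8 * r) * norm m"
        using r0 by simp
      also have "\<dots> \<le> (3 / 8 * r) * (1 / 3)"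
        using m r0 by (intro mult_left_mono) auto
      finally show ?thesis
        by simp
    qed
    have "norm c \<le> (1 - 3 / 8 * r) * (1 / 3)"
      unfolding c_def using m r1 by (simp add: mult_left_mono)
    then have c: "norm c \<le> 1 / 3 - r / 8"
      by simp
    have "m - y = (1 / 2) *\<^sub>R (z - y)" "m - z = (1 / 2) *\<^sub>R (y - z)"
      by (simp_all add: m_def vec_eq_iff field_simps)
    then have my: "norm (m - y) = r / 2" "norm (m - z) = r / 2"
      using rn by (simp_all add: norm_minus_commute)
    have cy: "norm (c - y) \<le> 5 / 8 * r" "norm (c - z) \<le> 5 / 8 * r"
      using norm_triangle_ineq[of "c - m" "m - y"] norm_triangle_ineq[of "c - m" "m - z"] cm my by simp_all
    have inB: "cball c (r / 8) \<subseteq> B"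
    proof
      fix p assume "p \<in> cball c (r / 8)"
      then show "p \<in> B"
        using norm_triangle_ineq[of c "p - c"] c by (auto simp: B_def dist_norm norm_minus_commute)
    qed
    moreover have "cball c (r / 8) \<subseteq> ball y r"
    proof
      fix p assume "p \<in> cball c (r / 8)"
      then show "p \<in> ball y r"
        using norm_triangle_ineq[of "p - c" "c - y"] cy r0 by (auto simp: dist_norm norm_minus_commute)
    qed
    moreover obtain x0 s0 where "norm x0 \<le> 1" "contact a \<Gamma> x0 z s0"
      using z(1) by (auto simp: Da_def touching_set_eq)
    then have "measure lebesgue (ball y (5 * r)) \<le> \<kappa> * measure lebesgue (touching_set b \<Gamma> \<inter> cball c (r / 8))"
      unfolding \<kappa>_def b_def n_def
      using c cy(2) r0 r1 a N inB[unfolded B_def]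
      by (intro measure_touching_set_near_contact[OF nh neg, of a x0 z s0]) (simp_all add: n_def norm_minus_commute)
    ultimately show ?thesis
      using r0 r1 \<open>ball y r \<inter> Da = {}\<close> by blast
  qed
  then obtain c r where cr: "\<And>y. y \<in> B - Da \<Longrightarrow> 0 < r y \<and> r y \<le> 2 / 3"
    "\<And>y. y \<in> B - Da \<Longrightarrow> cball (c y) (r y / 8) \<subseteq> ball y (r y) \<inter> B - Da"
    "\<And>y. y \<in> B - Da \<Longrightarrow>
      measure lebesgue (ball y (5 * r y)) \<le> \<kappa> * measure lebesgue (touching_set b \<Gamma> \<inter> cball (c y) (r y / 8))"
    by metis
  define E where "E y = touching_set b \<Gamma> \<inter> cball (c y) (r y / 8)" for y
  have "B - Da \<subseteq> (\<Union>y\<in>B - Da. ball y (r y))"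
    using cr(1) by force
  then obtain C where C: "countable C" "C \<subseteq> B - Da"
    "pairwise (\<lambda>x y. disjnt (ball x (r x)) (ball y (r y))) C"
    "B - Da \<subseteq> (\<Union>y\<in>C. ball y (5 * r y))"
    using Vitali_covering_lemma_balls[where S = "B - Da" and K = "B - Da" and a = "\<lambda>y. y" and r = r and B = "2 / 3"] cr(1)
    by blast
  have "pairwise (\<lambda>x y. disjnt (E x) (E y)) C"
    unfolding pairwise_def
  proof (intro ballI impI)
    fix x y assume xy: "x \<in> C" "y \<in> C" "x \<noteq> y"
    then have "disjnt (ball x (r x)) (ball y (r y))"
      using C(3) by (auto simp: pairwise_def)
    moreover have "E x \<subseteq> ball x (r x)" "E y \<subseteq> ball y (r y)"
      using cr(2)[of x] cr(2)[of y] C(2) xy(1,2) unfolding E_def by blast+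
    ultimately show "disjnt (E x) (E y)"
      by (meson disjnt_subset1 disjnt_subset2)
  qed
  moreover have "E y \<subseteq> Db - Da" if "y \<in> C" for y
    using cr(2)[of y] C(2) that unfolding E_def Db_def by blast
  moreover have "E y \<in> lmeasurable" for y
    unfolding E_def using compact_touching_set[OF cyl neg, of b] ab(2)
    by (intro lmeasurable_compact compact_Int) auto
  moreover have "measure lebesgue (ball y (5 * r y)) \<le> \<kappa> * measure lebesgue (E y)" if "y \<in> C" for y
    using cr(3)[of y] C(2) that unfolding E_def by blast
  moreover have "Db - Da \<in> lmeasurable"
    using meas by (intro fmeasurable_Diff) (auto dest: fmeasurableD)
  ultimately have UN: "(\<Union>y\<in>C. ball y (5 * r y)) \<in> lmeasurable"
    "measure lebesgue (\<Union>y\<in>C. ball y (5 * r y)) \<le> \<kappa> * measure lebesgue (Db - Da)"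
    using measure_UN_le_disjoint_subsets[OF C(1), of "\<lambda>y. ball y (5 * r y)" E "Db - Da" \<kappa>] \<kappa> by auto
  have "measure lebesgue (B - Da) \<le> measure lebesgue (\<Union>y\<in>C. ball y (5 * r y))"
    using C(4) UN(1) meas by (intro measure_mono_fmeasurable) (auto dest: fmeasurableD)
  then have le: "measure lebesgue (B - Da) \<le> \<kappa> * measure lebesgue (Db - Da)"
    using UN(2) by linarith
  have "Da \<subseteq> B" "Db \<subseteq> B"
    by (auto simp: Da_def Db_def)
  then have "measure lebesgue (B - Db) = measure lebesgue (B - Da) - measure lebesgue (Db - Da)"
    using meas sub by (simp add: measurable_measure_Diff fmeasurableD)
  also have "\<dots> \<le> (1 - 1 / \<kappa>) * measure lebesgue (B - Da)"
    using le \<kappa> by (simp add: field_simps)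
  finally have "measure lebesgue (B - Db) \<le> (1 - 1 / \<kappa>) * measure lebesgue (B - Da)" .
  moreover have "B - Db = B - touching_set b \<Gamma>" "B - Da = B - touching_set a \<Gamma>"
    by (auto simp: Da_def Db_def)
  ultimately show ?thesis
    by (simp add: B_def b_def \<kappa>_def)
qed

text \<open>
The paraboloid centered at the origin touches at distance at most \<open>sqrt (1/16 + 1/24) < 1/3\<close>, where
\<open>1/24\<close> comes from the depth \<open>a / 48\<close>.
\<close>

lemma touching_set_meets_third_ball:
  fixes \<Gamma> :: "((real ^ 'n) \<times> real) set"
  assumes cyl: "\<Gamma> \<subseteq> cylinder 1" and neg: "\<Gamma> \<subseteq> {x. snd x \<le> 0}"
    and p: "(y, s) \<in> \<Gamma>" "norm y \<le> 1 / 4" "- a / 48 \<le> s" and a: "0 < a"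
  shows "touching_set a \<Gamma> \<inter> cball 0 (1 / 3) \<noteq> {}"
proof -
  obtain z t where z: "contact a \<Gamma> 0 z t"
    using contact_exists[OF cyl neg, of a 0] p(1) by blast
  have "t \<le> 0"
    using z closure_bounds(2)[OF cyl neg] by (auto simp: contact_def)
  moreover have "s \<le> t + a / 2 * ((norm (y - 0))\<^sup>2 - (norm (z - 0))\<^sup>2)"
    by (rule contact_above[OF z p(1)])
  ultimately have "a * (norm z)\<^sup>2 \<le> a * ((norm y)\<^sup>2 + 1 / 24)"
    using p(3) by (simp add: algebra_simps)
  then have "(norm z)\<^sup>2 \<le> (norm y)\<^sup>2 + 1 / 24"
    using a by simp
  also have "(norm y)\<^sup>2 \<le> (1 / 4)\<^sup>2"
    using p(2) by (intro power_mono) auto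
  finally have "(norm z)\<^sup>2 \<le> (1 / 3)\<^sup>2"
    by (simp add: power2_eq_square)
  then have "norm z \<le> 1 / 3"
    by (rule power2_le_imp_le) simp
  moreover have "z \<in> touching_set a \<Gamma>"
    unfolding touching_set_eq using z norm_zero zero_le_one by (metis (mono_tags) mem_Collect_eq)
  ultimately show ?thesis
    by auto
qed

lemma measure_untouched_decay_iterated:
  fixes \<Gamma> :: "((real ^ 'n) \<times> real) set"
  defines "n \<equiv> real CARD('n)"
  assumes nh: "nh_subset h (cylinder 1) \<Gamma>" and neg: "\<Gamma> \<subseteq> {x. snd x \<le> 0}"
    and N: "8192 * barrier_depth n \<le> N" "barrier_size n \<le> N + 1" "20 \<le> N + 1"
    and a: "0 < a" "h \<le> a" and j: "(N + 1) ^ (j + 1) * a \<le> 1"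
    and ne: "touching_set a \<Gamma> \<inter> cball 0 (1 / 3) \<noteq> {}"
  shows "measure lebesgue (cball 0 (1 / 3) - touching_set ((N + 1) ^ j * a) \<Gamma>)
    \<le> (1 - 1 / (230400 * n) ^ CARD('n)) ^ j * measure lebesgue (cball (0 :: real ^ 'n) (1 / 3))"
  using j
proof (induction j)
  case 0
  have "compact (touching_set a \<Gamma>)"
    using compact_touching_set[OF nh_subset_cylinder[OF nh] neg] a by simp
  then have "measure lebesgue (cball 0 (1 / 3) - touching_set a \<Gamma>) \<le> measure lebesgue (cball (0 :: real ^ 'n) (1 / 3))"
    by (intro measure_mono_fmeasurable sets.Diff) (auto simp: lmeasurable_compact fmeasurableD)
  then show ?case
    by simp
next
  case (Suc j)
  define \<kappa> where "\<kappa> = (230400 * n) ^ CARD('n)"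
  have n1: "1 \<le> n"
    unfolding n_def using zero_less_card_finite[where 'a = 'n] by linarith
  then have "1 \<le> 230400 * n"
    by simp
  then have \<kappa>: "1 \<le> \<kappa>"
    unfolding \<kappa>_def by (rule one_le_power)
  define b where "b = (N + 1) ^ j * a"
  have N0: "1 \<le> N + 1" "0 < N + 1"
    using N(3) by auto
  have b0: "0 < b"
    using a N0 by (simp add: b_def)
  have ab: "a \<le> b"
    using one_le_power[OF N0(1), of j] a by (simp add: b_def)
  have bb: "(N + 1) * ((N + 1) * b) \<le> 1"
    using Suc.prems by (simp add: b_def mult_ac)
  have "(N + 1) * b \<le> (N + 1) * ((N + 1) * b)"
    using N0 b0 by simp
  then have b1: "(N + 1) * b \<le> 1"
    using bb by linarith
  have "b * barrier_size n \<le> b * (N + 1)"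
    using N b0 by (intro mult_left_mono) auto
  then have b2: "b * barrier_size n \<le> 1"
    using b1 by (simp add: mult.commute)
  have "20 * ((N + 1) * b) \<le> (N + 1) * ((N + 1) * b)"
    using N(3) N0 b0 by (intro mult_right_mono) auto
  then have b3: "(N + 1) * b \<le> 1 / 20"
    using bb by linarith
  have "touching_set b \<Gamma> \<inter> cball 0 (1 / 3) \<noteq> {}"
    using ne touching_set_mono[OF nh_subset_cylinder[OF nh] neg a(1) ab] by blast
  then have "measure lebesgue (cball 0 (1 / 3) - touching_set ((N + 1) * b) \<Gamma>)
    \<le> (1 - 1 / \<kappa>) * measure lebesgue (cball 0 (1 / 3) - touching_set b \<Gamma>)"
    unfolding \<kappa>_def n_def using N(1) b0 b2 b3 ab a(2)
    by (intro measure_untouched_decay[OF nh neg]) (auto simp: n_def)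
  also have "\<dots> \<le> (1 - 1 / \<kappa>) * ((1 - 1 / \<kappa>) ^ j * measure lebesgue (cball (0 :: real ^ 'n) (1 / 3)))"
    using Suc.IH b1 \<kappa> by (intro mult_left_mono) (simp_all add: b_def \<kappa>_def mult.assoc)
  finally show ?case
    by (simp add: b_def \<kappa>_def mult.assoc)
qed

theorem theorem1p5:
  shows "\<exists>\<alpha> \<beta> :: real. \<alpha> > 1 \<and> 0 < \<beta> \<and> \<beta> < 1 \<and>
    (\<forall>\<mu>::real. \<mu> > 0 \<longrightarrow> (\<exists>k::nat. k \<ge> 1 \<and>
      (\<forall>(h::real) (\<Gamma> :: ((real ^ 'n) \<times> real) set).
         0 \<le> h \<and> h < 1 / \<alpha> ^ (k + 1) \<and>
         nh_subset h (cylinder 1) \<Gamma> \<and>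
         hausdorff CARD('n) \<Gamma> < \<infinity> \<and>
         \<Gamma> \<subseteq> {x. snd x \<le> 0} \<and>
         \<Gamma> \<inter> {x. norm (fst x) \<le> 1 / 4 \<and> - (1 / \<alpha> ^ (k + 1)) / 48 \<le> snd x \<and> snd x \<le> 0} \<noteq> {}
         \<longrightarrow>
         measure lebesgue (cball (0 :: real ^ 'n) (1 / 3) - touching_set (1 / \<alpha>) \<Gamma>)
           \<le> \<mu> * measure lebesgue (cball (0 :: real ^ 'n) (1 / 3)))))"
proof -
  define n where "n = real CARD('n)"
  have n1: "1 \<le> n"
    unfolding n_def using zero_less_card_finite[where 'a = 'n] by linarith
  \<comment> \<open>With \<open>\<alpha> = N + 1\<close>, all openings up to \<open>\<alpha>\<^sup>-\<^sup>1\<close> are small enough for both barriers.\<close>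
  define N where "N = 8192 * barrier_depth n + barrier_size n + 20"
  have pos: "0 \<le> barrier_depth n" "0 \<le> barrier_size n"
    using n1 by (simp_all add: barrier_size_def barrier_depth_def)
  then have N: "8192 * barrier_depth n \<le> N" "barrier_size n \<le> N + 1" "20 \<le> N + 1"
    by (auto simp: N_def)
  define \<alpha> where "\<alpha> = N + 1"
  have \<alpha>: "1 < \<alpha>" "0 < \<alpha>"
    using N(3) by (auto simp: \<alpha>_def)
  define \<beta> where "\<beta> = 1 - 1 / (230400 * n) ^ CARD('n)"
  have "1 < (230400 * n) ^ CARD('n)"
    using n1 by (intro one_less_power) auto
  then have \<beta>: "0 < \<beta>" "\<beta> < 1"
    by (auto simp: \<beta>_def)
  have main: "measure lebesgue (cball (0 :: real ^ 'n) (1 / 3) - touching_set (1 / \<alpha>) \<Gamma>)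
      \<le> \<mu> * measure lebesgue (cball (0 :: real ^ 'n) (1 / 3))"
    if k: "\<beta> ^ k \<le> \<mu>" and h: "h < 1 / \<alpha> ^ (k + 1)" and nh: "nh_subset h (cylinder 1) \<Gamma>"
      and neg: "\<Gamma> \<subseteq> {x. snd x \<le> 0}"
      and p: "(y, s) \<in> \<Gamma>" "norm y \<le> 1 / 4" "- (1 / \<alpha> ^ (k + 1)) / 48 \<le> s"
    for \<mu> h k y s and \<Gamma> :: "((real ^ 'n) \<times> real) set"
  proof -
    define a where "a = 1 / \<alpha> ^ (k + 1)"
    have a: "0 < a" "h \<le> a" "\<alpha> ^ (k + 1) * a \<le> 1" "\<alpha> ^ k * a = 1 / \<alpha>"
      using \<alpha> h by (auto simp: a_def)
    have "touching_set a \<Gamma> \<inter> cball 0 (1 / 3) \<noteq> {}"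
      using touching_set_meets_third_ball[OF nh_subset_cylinder[OF nh] neg p(1,2)] p(3) a(1)
      by (simp add: a_def)
    then have "measure lebesgue (cball 0 (1 / 3) - touching_set (\<alpha> ^ k * a) \<Gamma>)
        \<le> \<beta> ^ k * measure lebesgue (cball (0 :: real ^ 'n) (1 / 3))"
      using measure_untouched_decay_iterated[OF nh neg N[unfolded n_def] a(1,2)] a(3)
      by (simp add: \<beta>_def n_def \<alpha>_def)
    also have "\<dots> \<le> \<mu> * measure lebesgue (cball (0 :: real ^ 'n) (1 / 3))"
      using k by (intro mult_right_mono) auto
    finally show ?thesis
      by (simp add: a(4))
  qed
  have ex: "\<exists>k\<ge>1. \<beta> ^ k \<le> \<mu>" if \<mu>: "0 < \<mu>" for \<mu>
  proof -
    obtain k where "\<beta> ^ k < \<mu>"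
      using real_arch_pow_inv[OF \<mu> \<beta>(2)] by auto
    moreover have "\<beta> ^ Suc k \<le> \<beta> ^ k"
      using \<beta> by (intro power_decreasing) auto
    ultimately show ?thesis
      by (intro exI[of _ "Suc k"]) auto
  qed
  show ?thesis
  proof (rule exI[of _ \<alpha>], rule exI[of _ \<beta>], intro conjI allI impI)
    fix \<mu> :: real assume "0 < \<mu>"
    then obtain k where "1 \<le> k" "\<beta> ^ k \<le> \<mu>"
      using ex by blast
    show "\<exists>k\<ge>1. \<forall>h (\<Gamma> :: ((real ^ 'n) \<times> real) set).
         0 \<le> h \<and> h < 1 / \<alpha> ^ (k + 1) \<and>
         nh_subset h (cylinder 1) \<Gamma> \<and>
         hausdorff CARD('n) \<Gamma> < \<infinity> \<and>
         \<Gamma> \<subseteq> {x. snd x \<le> 0} \<and>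
         \<Gamma> \<inter> {x. norm (fst x) \<le> 1 / 4 \<and> - (1 / \<alpha> ^ (k + 1)) / 48 \<le> snd x \<and> snd x \<le> 0} \<noteq> {}
         \<longrightarrow>
         measure lebesgue (cball (0 :: real ^ 'n) (1 / 3) - touching_set (1 / \<alpha>) \<Gamma>)
           \<le> \<mu> * measure lebesgue (cball (0 :: real ^ 'n) (1 / 3))"
    proof (intro exI[of _ k] conjI allI impI)
      fix h and \<Gamma> :: "((real ^ 'n) \<times> real) set"
      assume *: "0 \<le> h \<and> h < 1 / \<alpha> ^ (k + 1) \<and> nh_subset h (cylinder 1) \<Gamma> \<and>
         hausdorff CARD('n) \<Gamma> < \<infinity> \<and> \<Gamma> \<subseteq> {x. snd x \<le> 0} \<and>
         \<Gamma> \<inter> {x. norm (fst x) \<le> 1 / 4 \<and> - (1 / \<alpha> ^ (k + 1)) / 48 \<le> snd x \<and> snd x \<le> 0} \<noteq> {}"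
      then obtain p where "p \<in> \<Gamma>" "norm (fst p) \<le> 1 / 4" "- (1 / \<alpha> ^ (k + 1)) / 48 \<le> snd p"
        by blast
      then show "measure lebesgue (cball (0 :: real ^ 'n) (1 / 3) - touching_set (1 / \<alpha>) \<Gamma>)
           \<le> \<mu> * measure lebesgue (cball (0 :: real ^ 'n) (1 / 3))"
        using main[of k \<mu> h \<Gamma> "fst p" "snd p"] * \<open>\<beta> ^ k \<le> \<mu>\<close> by simp
    qed fact
  qed (use \<alpha> \<beta> in auto)
qed

end
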